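(* There exist a discrete nonelementary Fuchsian group $G\le\mathrm{Isom}(\mathbb H^2)$ and a point $\xi$ in the limit set $\Lambda$ of $G$ such that $\dim_H(\mathrm{VWA}_\xi)=0$.
   Context: $X=\mathbb H^2$ is the hyperbolic plane with hyperbolic metric $d$, $o\in\mathbb H^2$ is a basepoint (the point $i$ of the upper half-plane), and $\partial X$ carries the visual metric $D$, which is the spherical metric $|dx|/(1+|x|^2)$ on $\mathbb R\cup\{\infty\}$; $\dim_H$ is Hausdorff dimension. $\Lambda\subset\partial X$ is the set of accumulation points of $G(o)$; $G$ is nonelementary if $\Lambda$ has at least three points. The radial limit set $\Lambda_r$ is the set of $\eta\in\partial X$ for which there is a sequence $(g_n)$ in $G$ such that $g_n(o)\to\eta$ while staying within a bounded distance of the geodesic ray from $o$ to $\eta$. For $\eta\in\Lambda_r$, $$\omega_\xi(\eta)=\limsup_{g\in G,\ d(o,g(o))\to\infty}\frac{-\log D(g(\xi),\eta)}{d(o,g(o))},\qquad \mathrm{VWA}_\xi=\{\eta\in\Lambda_r:\omega_\xi(\eta)>1\}.$$ *)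

theory Defs
  imports "HOL-Analysis.Analysis" "HOL-Algebra.Bij"
begin

section \<open>The hyperbolic plane and its isometry group\<close>

definition upper_half_plane :: "complex set" where
  "upper_half_plane = {z. Im z > 0}"

definition hyp_dist :: "complex \<Rightarrow> complex \<Rightarrow> real" where
  "hyp_dist z w = arcosh (1 + (cmod (z - w))\<^sup>2 / (2 * Im z * Im w))"

text \<open>As in \<open>BijGroup\<close>, isometries are functions on \<open>complex\<close> that are \<open>undefined\<close> outside the
  half plane, so that equality of functions is equality of isometries.\<close>

definition Isom_H2 :: "(complex \<Rightarrow> complex) monoid" where
  "Isom_H2 = BijGroup upper_half_plane
     \<lparr>carrier := {g \<in> Bij upper_half_plane.
        \<forall>z\<in>upper_half_plane. \<forall>w\<in>upper_half_plane. hyp_dist (g z) (g w) = hyp_dist z w}\<rparr>"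

text \<open>A hyperbolic isometry preserves orientation iff it is holomorphic. The predicate
  \<^const>\<open>discrete\<close> refers to the product topology on \<open>complex \<Rightarrow> complex\<close>; on \<open>Isom_H2\<close> this is the
  topology of pointwise convergence, which for isometries is the compact-open topology, that is,
  the usual topology of the Lie group of isometries.\<close>

definition fuchsian_group :: "(complex \<Rightarrow> complex) set \<Rightarrow> bool" where
  "fuchsian_group G \<longleftrightarrow>
     subgroup G Isom_H2 \<and> (\<forall>g\<in>G. g holomorphic_on upper_half_plane) \<and> discrete G"

abbreviation basepoint :: complex where
  "basepoint \<equiv> \<i>"

section \<open>The boundary with its visual metric\<close>

datatype bdry = Real_Pt real | Infinity_Pt

text \<open>The substitution \<open>x = tan \<theta>\<close> turns the line element \<open>|dx| / (1 + |x|\<^sup>2)\<close> into \<open>|d\<theta>|\<close>: with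
  respect to the arc length \<open>\<theta>\<close>, the boundary is a circle of circumference \<open>pi\<close>, and the two arcs
  between points with parameters \<open>\<theta>\<close> and \<open>\<theta>'\<close> have lengths \<open>|\<theta> - \<theta>'|\<close> and \<open>pi - |\<theta> - \<theta>'|\<close>.\<close>

primrec arc_param :: "bdry \<Rightarrow> real" where
  "arc_param (Real_Pt x) = arctan x"
| "arc_param Infinity_Pt = pi / 2"

lemma arc_param_bounds: "- (pi / 2) < arc_param x" "arc_param x \<le> pi / 2"
  using arctan_ubound less_imp_le by (cases x; auto simp: arctan_lbound)+

lemma arc_param_inject: "arc_param x = arc_param y \<longleftrightarrow> x = y"
proof -
  have "arctan t * 2 \<noteq> pi" "pi \<noteq> arctan t * 2" for t
    using arctan_ubound[of t] by linarith+
  then show ?thesis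
    by (cases x; cases y) (simp_all add: arctan_eq_iff)
qed

instantiation bdry :: metric_space
begin

definition dist_bdry :: "bdry \<Rightarrow> bdry \<Rightarrow> real" where
  "dist_bdry x y = min \<bar>arc_param x - arc_param y\<bar> (pi - \<bar>arc_param x - arc_param y\<bar>)"

definition uniformity_bdry :: "(bdry \<times> bdry) filter" where
  "uniformity_bdry = (INF e\<in>{0<..}. principal {(x, y). dist x y < e})"

definition open_bdry :: "bdry set \<Rightarrow> bool" where
  "open_bdry U \<longleftrightarrow> (\<forall>x\<in>U. eventually (\<lambda>(x', y). x' = x \<longrightarrow> y \<in> U) uniformity)"

instance
proof
  fix x y z :: bdry
  note b = arc_param_bounds[of x] arc_param_bounds[of y] arc_param_bounds[of z]
  show "dist x y = 0 \<longleftrightarrow> x = y"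
    using b pi_gt_zero unfolding dist_bdry_def arc_param_inject[of x y, symmetric]
    by (auto simp: min_def abs_if split: if_splits)
  show "dist x y \<le> dist x z + dist y z"
    using b pi_gt_zero unfolding dist_bdry_def min_def abs_if
    by (simp split: if_splits)
qed (simp_all add: uniformity_bdry_def open_bdry_def)

end

text \<open>The filter of neighbourhoods of a boundary point, traced on the half plane.\<close>

definition bdry_nhds :: "bdry \<Rightarrow> complex filter" where
  "bdry_nhds \<eta> =
     inf (case \<eta> of Real_Pt x \<Rightarrow> nhds (complex_of_real x) | Infinity_Pt \<Rightarrow> at_infinity)
         (principal upper_half_plane)"

text \<open>The action of an isometry on the boundary, by continuous extension.\<close>

definition bdry_ext :: "(complex \<Rightarrow> complex) \<Rightarrow> bdry \<Rightarrow> bdry" where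
  "bdry_ext g \<xi> = (THE \<eta>. filterlim g (bdry_nhds \<eta>) (bdry_nhds \<xi>))"

section \<open>Limit sets\<close>

text \<open>A sequence in an orbit that converges to a boundary point takes infinitely many values, so
  no distinctness is required.\<close>

definition limit_set :: "(complex \<Rightarrow> complex) set \<Rightarrow> bdry set" where
  "limit_set G =
     {\<eta>. \<exists>g. range g \<subseteq> G \<and> filterlim (\<lambda>n::nat. g n basepoint) (bdry_nhds \<eta>) sequentially}"

definition nonelementary :: "(complex \<Rightarrow> complex) set \<Rightarrow> bool" where
  "nonelementary G \<longleftrightarrow> (\<exists>S \<subseteq> limit_set G. card S = 3)"

definition geodesic_ray :: "(real \<Rightarrow> complex) \<Rightarrow> complex \<Rightarrow> bdry \<Rightarrow> bool" where
  "geodesic_ray r p \<eta> \<longleftrightarrow>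
     r 0 = p \<and> r ` {0..} \<subseteq> upper_half_plane \<and>
     (\<forall>s\<ge>0. \<forall>t\<ge>0. hyp_dist (r s) (r t) = \<bar>s - t\<bar>) \<and>
     filterlim r (bdry_nhds \<eta>) at_top"

definition radial_limit_set :: "(complex \<Rightarrow> complex) set \<Rightarrow> bdry set" where
  "radial_limit_set G =
     {\<eta>. \<exists>g r C. range g \<subseteq> G \<and>
          filterlim (\<lambda>n::nat. g n basepoint) (bdry_nhds \<eta>) sequentially \<and>
          geodesic_ray r basepoint \<eta> \<and>
          (\<forall>n. \<exists>t\<ge>0. hyp_dist (g n basepoint) (r t) \<le> C)}"

section \<open>Approximation by an orbit of a boundary point\<close>

text \<open>For \<open>t \<ge> 0\<close>; the library has \<open>ln 0 = 0\<close>, whereas \<open>- log 0\<close> has to be infinite here.\<close>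

definition neg_log :: "real \<Rightarrow> ereal" where
  "neg_log t = (if t = 0 then \<infinity> else ereal (- ln t))"

definition displacement :: "(complex \<Rightarrow> complex) \<Rightarrow> real" where
  "displacement g = hyp_dist basepoint (g basepoint)"

definition approx_exponent :: "(complex \<Rightarrow> complex) set \<Rightarrow> bdry \<Rightarrow> bdry \<Rightarrow> ereal" where
  "approx_exponent G \<xi> \<eta> =
     Limsup (inf (filtercomap displacement at_top) (principal G))
       (\<lambda>g. neg_log (dist (bdry_ext g \<xi>) \<eta>) / ereal (displacement g))"

definition VWA :: "(complex \<Rightarrow> complex) set \<Rightarrow> bdry \<Rightarrow> bdry set" where
  "VWA G \<xi> = {\<eta> \<in> radial_limit_set G. approx_exponent G \<xi> \<eta> > 1}"

section \<open>Hausdorff dimension\<close>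

definition hausdorff_premeasure :: "real \<Rightarrow> real \<Rightarrow> 'a::metric_space set \<Rightarrow> ennreal" where
  "hausdorff_premeasure s \<delta> A =
     (INF U \<in> {U :: nat \<Rightarrow> 'a set. A \<subseteq> (\<Union>i. U i) \<and> (\<forall>i. bounded (U i) \<and> diameter (U i) \<le> \<delta>)}.
        \<Sum>i. ennreal (diameter (U i) powr s))"

definition hausdorff_measure :: "real \<Rightarrow> 'a::metric_space set \<Rightarrow> ennreal" where
  "hausdorff_measure s A = (SUP \<delta> \<in> {0<..}. hausdorff_premeasure s \<delta> A)"

text \<open>Restricting to \<open>s > 0\<close> does not change the infimum, since \<open>hausdorff_measure s A = 0\<close> is
  preserved when \<open>s\<close> increases; it makes the convention for \<open>0 powr 0\<close> irrelevant.\<close>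

definition hausdorff_dim :: "'a::metric_space set \<Rightarrow> ereal" where
  "hausdorff_dim A = (INF s \<in> {s. s > 0 \<and> hausdorff_measure s A = 0}. ereal s)"

end

theory Submission
  imports Defs "HOL-Real_Asymp.Real_Asymp"
begin

text \<open>
  Let \<open>G\<close> be a discrete group and let \<open>\<xi>\<close> be one of its limit points. Suppose that \<open>\<eta>\<close> is a limit
  point with \<open>D(g \<xi>, \<eta>) \<le> e\<^bsup>-c d\<^esup>\<close>, where \<open>d\<close> is the displacement \<open>d(o, g o)\<close> and \<open>c > 1\<close>. Every
  isometry of displacement \<open>d\<close> is Lipschitz for the visual metric with constant \<open>O(e\<^sup>d)\<close>
  (\<open>dist_moebius_bdry_le\<close>), so the limit point \<open>g\<^sup>-\<^sup>1 \<eta>\<close> lies at distance \<open>O(e\<^bsup>-(c-1)d\<^esup>)\<close> from \<open>\<xi>\<close>. Very good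
  approximation of \<open>\<eta>\<close> by the orbit of \<open>\<xi>\<close> is thus governed by the size of the limit set near \<open>\<xi>\<close>, and
  it becomes rare when the limit set is very sparse there.

  In the example, the limit set without \<open>\<xi>\<close> is covered by arcs \<open>C\<^sub>j\<close> at distance at least \<open>1/(2j+2)\<close>
  from \<open>\<xi>\<close> and of length \<open>O(4\<^bsup>-j^2\<^esup>)\<close>. If \<open>g\<^sup>-\<^sup>1 \<eta>\<close> lies in \<open>C\<^sub>j\<close>, then \<open>j\<close> is at least of order
  \<open>e\<^bsup>(c-1)d\<^esup>\<close>, hence exceeds \<open>d\<close> once \<open>d\<close> is large. Therefore \<open>VWA\<^sub>\<xi>\<close> is contained, up to the
  countable orbit of \<open>\<xi>\<close>, in the limsup of the sets \<open>g(C\<^sub>j)\<close> with \<open>e\<^sup>d \<le> 4\<^sup>j\<close> up to a constant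
  (\<open>VWA_subset_limsup\<close>). For each \<open>j\<close> only exponentially many such \<open>g\<close> exist, whereas \<open>g(C\<^sub>j)\<close> has
  diameter \<open>O(4\<^bsup>j - j^2\<^esup>)\<close>; so the sum of the \<open>s\<close>-th powers of the diameters converges for every \<open>s > 0\<close>,
  and the Hausdorff dimension is \<open>0\<close> (\<open>hausdorff_dim_eq_0I\<close>).

  The group is generated by the involutions \<open>z \<mapsto> x\<^sub>j - r\<^sub>j\<^sup>2 / (z - x\<^sub>j)\<close>, each of which exchanges the inside
  and the outside of the disc with centre \<open>x\<^sub>j\<close> and radius \<open>r\<^sub>j\<close>. The discs are pairwise disjoint and
  tend to \<open>\<xi> = \<infinity>\<close>; by the ping-pong argument the orbit of \<open>o\<close> lies in their union, apart from \<open>o\<close>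
  itself, and the arcs \<open>C\<^sub>j\<close> are the traces of the discs on the real line. The numbers \<open>x\<^sub>j\<close> and
  \<open>r\<^sub>j\<close> are chosen so that the involutions have integer matrices. A matrix of determinant \<open>1\<close> satisfies
  \<open>a\<^sup>2 + b\<^sup>2 + c\<^sup>2 + d\<^sup>2 = 2 cosh d(o, g o)\<close>, so discreteness and the counting of group elements reduce to
  counting integer matrices.
\<close>

section \<open>Hausdorff dimension zero from a limsup cover\<close>

lemma hausdorff_premeasure_le_double_cover:
  fixes V :: "nat \<Rightarrow> nat \<Rightarrow> 'a::metric_space set"
  assumes "A \<subseteq> (\<Union>m n. V m n)"
    and "\<And>m n. bounded (V m n)" and "\<And>m n. diameter (V m n) \<le> \<delta>"
  shows "hausdorff_premeasure s \<delta> A \<le> (\<Sum>m. \<Sum>n. ennreal (diameter (V m n) powr s))"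
proof -
  define U where "U i = case_prod V (prod_decode i)" for i
  have "A \<subseteq> (\<Union>i. U i)"
  proof
    fix x assume "x \<in> A"
    then obtain m n where "x \<in> V m n"
      using assms(1) by blast
    then have "x \<in> U (prod_encode (m, n))"
      by (simp add: U_def)
    then show "x \<in> (\<Union>i. U i)" by blast
  qed
  moreover have "bounded (U i) \<and> diameter (U i) \<le> \<delta>" for i
    using assms(2,3) by (simp add: U_def split: prod.split)
  ultimately have "hausdorff_premeasure s \<delta> A \<le> (\<Sum>i. ennreal (diameter (U i) powr s))"
    unfolding hausdorff_premeasure_def by (intro INF_lower) auto
  also have "\<dots> = (\<Sum>i. (\<lambda>(m, n). ennreal (diameter (V m n) powr s)) (prod_decode i))"
    by (simp add: U_def case_prod_unfold)
  also have "\<dots> = (\<Sum>m. \<Sum>n. ennreal (diameter (V m n) powr s))"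
    by (rule suminf_ennreal_2dimen) simp
  finally show ?thesis .
qed

text \<open>
  The Borel-Cantelli argument for Hausdorff measures. The countable set \<open>Z\<close> is covered by points,
  which contribute nothing.
\<close>

lemma hausdorff_dim_eq_0I:
  fixes A Z :: "'a::metric_space set" and F :: "nat \<Rightarrow> 'b set"
  assumes Z: "countable Z"
    and cover: "\<And>N. A \<subseteq> Z \<union> (\<Union>j\<in>{N..}. \<Union>g\<in>F j. U j g)"
    and fin: "\<And>j. finite (F j)"
    and bdd: "\<And>j g. g \<in> F j \<Longrightarrow> bounded (U j g)"
    and diam: "\<And>j g. g \<in> F j \<Longrightarrow> diameter (U j g) \<le> \<rho> j"
    and \<rho>: "\<And>j. 0 \<le> \<rho> j" "\<rho> \<longlonglongrightarrow> 0"
    and sum: "\<And>s. s > 0 \<Longrightarrow> summable (\<lambda>j. real (card (F j)) * \<rho> j powr s)"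
  shows "hausdorff_dim A = 0"
proof -
  have premeasure_le: "hausdorff_premeasure s \<delta> A \<le> ennreal \<epsilon>"
    if pos: "s > 0" "\<delta> > 0" "\<epsilon> > 0" for s \<delta> \<epsilon> :: real
  proof -
    define f where "f j = real (card (F j)) * \<rho> j powr s" for j
    have f: "summable f" "\<And>j. f j \<ge> 0"
      using sum[OF \<open>s > 0\<close>] unfolding f_def by auto
    have "\<forall>\<^sub>F N in sequentially. \<forall>j\<ge>N. \<rho> j < \<delta>"
      using order_tendstoD(2)[OF \<rho>(2) \<open>\<delta> > 0\<close>] by (rule eventually_all_ge_at_top)
    moreover have "\<forall>\<^sub>F N in sequentially. (\<Sum>j. f (j + N)) < \<epsilon>"
      using order_tendstoD(2)[OF suminf_exist_split2[OF f(1)] \<open>\<epsilon> > 0\<close>] .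
    ultimately have "\<forall>\<^sub>F N in sequentially. (\<forall>j\<ge>N. \<rho> j < \<delta>) \<and> (\<Sum>j. f (j + N)) < \<epsilon>"
      by (rule eventually_conj)
    then obtain N where N: "\<And>j. j \<ge> N \<Longrightarrow> \<rho> j < \<delta>" "(\<Sum>j. f (j + N)) < \<epsilon>"
      by (auto dest!: eventually_happens)
    \<comment> \<open>Inserting a point makes \<open>Z\<close> nonempty, so that it can be enumerated.\<close>
    define z where "z = from_nat_into (insert undefined Z)"
    define e where "e j = from_nat_into (F j)" for j
    \<comment> \<open>Row 0 consists of the points of \<open>Z\<close>, row \<open>k + 1\<close> of the sets \<open>U (k + N) g\<close>, padded with
      empty sets. Neither points nor empty sets contribute, as \<open>0 powr s = 0\<close>.\<close>
    define V where "V m n = (if m = 0 then {z n}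
      else if n < card (F (m - 1 + N)) then U (m - 1 + N) (e (m - 1 + N) n) else {})" for m n
    have e_in: "e j n \<in> F j" if "n < card (F j)" for j n
      using that unfolding e_def by (intro from_nat_into) auto
    have "A \<subseteq> (\<Union>m n. V m n)"
    proof
      fix x assume "x \<in> A"
      then consider "x \<in> Z" | j g where "j \<ge> N" "g \<in> F j" "x \<in> U j g"
        using cover[of N] by blast
      then show "x \<in> (\<Union>m n. V m n)"
      proof cases
        case 1
        then obtain n where "z n = x"
          using Z from_nat_into_surj[of "insert undefined Z" x] by (auto simp: z_def)
        then have "x \<in> V 0 n" by (simp add: V_def)
        then show ?thesis by blast
      next
        case 2
        then obtain n where "n < card (F j)" "e j n = g"
          using bij_betw_from_nat_into_finite[OF fin[of j]] unfolding bij_betw_def e_def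
          by (metis (no_types, lifting) imageE lessThan_iff)
        then have "x \<in> V (Suc (j - N)) n"
          using 2 by (simp add: V_def)
        then show ?thesis by blast
      qed
    qed
    moreover have "bounded (V m n)" for m n
      using bdd[OF e_in] by (simp add: V_def)
    moreover have "diameter (V m n) \<le> \<delta>" for m n
    proof (cases m)
      case (Suc k)
      then show ?thesis
        using diam[OF e_in, of n "k + N"] N(1)[of "k + N"] \<open>\<delta> > 0\<close> by (auto simp: V_def)
    qed (simp add: V_def \<open>\<delta> > 0\<close> less_imp_le)
    ultimately have "hausdorff_premeasure s \<delta> A
        \<le> (\<Sum>m. \<Sum>n. ennreal (diameter (V m n) powr s))"
      by (rule hausdorff_premeasure_le_double_cover)
    also have "\<dots> = (\<Sum>m. \<Sum>n. ennreal (diameter (V (Suc m) n) powr s))"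
      by (subst suminf_offset[where i = 1]) (auto simp: V_def)
    also have "\<dots> \<le> (\<Sum>m. ennreal (f (m + N)))"
    proof (rule suminf_le)
      fix m
      let ?j = "m + N"
      have "(\<Sum>n. ennreal (diameter (V (Suc m) n) powr s))
          = (\<Sum>n<card (F ?j). ennreal (diameter (U ?j (e ?j n)) powr s))"
        by (subst suminf_finite[where N = "{..<card (F ?j)}"]) (auto simp: V_def)
      also have "\<dots> \<le> (\<Sum>n<card (F ?j). ennreal (\<rho> ?j powr s))"
        using diam[OF e_in] bdd[OF e_in] \<open>s > 0\<close>
        by (intro sum_mono ennreal_leI powr_mono2) (auto intro!: diameter_ge_0)
      also have "\<dots> = ennreal (f ?j)"
        by (simp add: f_def ennreal_mult' ennreal_of_nat_eq_real_of_nat)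
      finally show "(\<Sum>n. ennreal (diameter (V (Suc m) n) powr s)) \<le> ennreal (f ?j)" .
    qed auto
    also have "\<dots> = ennreal (\<Sum>m. f (m + N))"
      using f by (intro suminf_ennreal2) (auto simp: summable_iff_shift)
    also have "\<dots> \<le> ennreal \<epsilon>"
      using N(2) by (intro ennreal_leI) simp
    finally show ?thesis .
  qed
  have measure: "hausdorff_measure s A = 0" if "s > 0" for s
  proof -
    have "hausdorff_premeasure s \<delta> A \<le> 0" if "\<delta> > 0" for \<delta>
    proof (rule ennreal_le_epsilon)
      fix e :: real assume "e > 0"
      then show "hausdorff_premeasure s \<delta> A \<le> 0 + ennreal e"
        using premeasure_le[OF \<open>s > 0\<close> that] by (simp only: add_0)
    qed
    then have "hausdorff_measure s A \<le> 0"
      unfolding hausdorff_measure_def by (intro SUP_least) auto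
    then show ?thesis by (simp only: le_zero_eq)
  qed
  have "hausdorff_dim A \<le> 0"
  proof (rule ereal_le_epsilon2)
    fix s :: real assume "s > 0"
    then have "hausdorff_dim A \<le> ereal s"
      unfolding hausdorff_dim_def using measure by (intro INF_lower) auto
    then show "hausdorff_dim A \<le> 0 + ereal s" by simp
  qed
  moreover have "hausdorff_dim A \<ge> 0"
    unfolding hausdorff_dim_def by (intro INF_greatest) auto
  ultimately show ?thesis by (rule antisym)
qed

section \<open>The visual metric\<close>

lemma abs_arctan_diff_le: "\<bar>arctan x - arctan y\<bar> \<le> \<bar>x - y\<bar>"
proof -
  have "arctan b - arctan a \<le> b - a" if "a \<le> b" for a b :: real
  proof -
    have "\<exists>z. a < z \<and> z < b \<and> arctan b - arctan a = (b - a) * inverse (1 + z\<^sup>2)" if "a < b"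
      by (rule MVT2) (use that in \<open>auto intro!: DERIV_arctan\<close>)
    moreover have "(b - a) * inverse (1 + z\<^sup>2) \<le> (b - a) * 1" for z
      using \<open>a \<le> b\<close> by (intro mult_left_mono) (auto simp: inverse_le_1_iff)
    ultimately show ?thesis using that by (cases "a = b") force+
  qed
  from this[of x y] this[of y x] show ?thesis
    by (cases x y rule: linorder_le_cases) (auto simp: arctan_le_iff)
qed

text \<open>
  The sine of the visual distance is the area spanned by two unit vectors in the plane, on which
  linear maps act by an explicit factor; and it is comparable to the distance.
\<close>

lemma sin_dist_bdry: "sin (dist x y) = \<bar>sin (arc_param x - arc_param y)\<bar>"
proof -
  let ?u = "arc_param x - arc_param y"
  have *: "\<bar>sin u\<bar> = sin \<bar>u\<bar>" if "\<bar>u\<bar> < pi" for u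
    using sin_ge_zero[of u] sin_ge_zero[of "- u"] that by (auto simp: abs_if)
  have "\<bar>?u\<bar> < pi"
    using arc_param_bounds[of x] arc_param_bounds[of y] by linarith
  then have "\<bar>sin ?u\<bar> = sin \<bar>?u\<bar>"
    by (rule *)
  moreover have "sin (dist x y) = sin \<bar>?u\<bar>"
    by (auto simp: dist_bdry_def min_def)
  ultimately show ?thesis by simp
qed

lemma dist_bdry_le_sin: "dist x y \<le> 2 * sin (dist x y)" for x y :: bdry
proof -
  let ?t = "dist x y"
  have "min u (pi - u) \<le> pi / 2" for u by linarith
  then have "?t \<le> pi / 2" unfolding dist_bdry_def .
  then have t: "0 \<le> ?t" "?t \<le> pi / 2" by simp_all
  \<comment> \<open>The half-angle formula \<open>tan (t / 2) = sin t / (1 + cos t)\<close> and \<open>u \<le> tan u\<close>.\<close>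
  have "?t / 2 = arctan (tan (?t / 2))"
    using t pi_gt_zero by (intro arctan_tan[symmetric]) linarith+
  also have "\<dots> \<le> tan (?t / 2)"
    using abs_arctan_diff_le[of "tan (?t / 2)" 0] t pi_gt_zero tan_pos_pi2_le[of "?t / 2"]
    by (simp add: tan_pos_pi2_le)
  also have "\<dots> = sin ?t / (cos ?t + 1)"
    using tan_half[of "?t / 2"] by simp
  also have "\<dots> \<le> sin ?t / 1"
  proof (rule divide_left_mono)
    have "0 \<le> cos ?t" "0 \<le> sin ?t"
      using t pi_gt_zero by (intro cos_ge_zero sin_ge_zero; linarith)+
    then show "1 \<le> cos ?t + 1" "0 \<le> sin ?t" "0 < (cos ?t + 1) * 1" by simp_all
  qed
  finally show ?thesis by simp
qed

lemma dist_Real_Pt_le: "dist (Real_Pt x) (Real_Pt y) \<le> \<bar>x - y\<bar>"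
  using abs_arctan_diff_le[of x y] by (simp add: dist_bdry_def min_def)

lemma dist_Infinity_Real_ge: "1 / (1 + \<bar>x\<bar>) \<le> dist Infinity_Pt (Real_Pt x)"
proof -
  have "1 / (1 + \<bar>x\<bar>) \<le> 1 / sqrt (1 + x\<^sup>2)"
    by (intro divide_left_mono real_le_lsqrt)
       (auto simp: power2_eq_square algebra_simps add_pos_nonneg)
  also have "\<dots> = \<bar>sin (pi / 2 - arctan x)\<bar>"
    by (simp add: sin_cos_eq[symmetric] sin_diff cos_arctan)
  also have "\<dots> = sin (dist Infinity_Pt (Real_Pt x))"
    by (simp add: sin_dist_bdry)
  also have "\<dots> \<le> dist Infinity_Pt (Real_Pt x)"
    by (rule sin_x_le_x) simp
  finally show ?thesis .
qed

section \<open>Neighbourhood filters of boundary points\<close>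

lemma filterlim_bdry_nhds:
  "filterlim f (bdry_nhds \<eta>) F \<longleftrightarrow>
     (case \<eta> of Real_Pt x \<Rightarrow> (f \<longlongrightarrow> complex_of_real x) F | Infinity_Pt \<Rightarrow> filterlim f at_infinity F)
     \<and> (\<forall>\<^sub>F z in F. f z \<in> upper_half_plane)"
  by (cases \<eta>) (auto simp: bdry_nhds_def filterlim_inf filterlim_principal)

lemma eventually_bdry_nhds_upper: "\<forall>\<^sub>F z in bdry_nhds \<eta>. z \<in> upper_half_plane"
  by (simp add: bdry_nhds_def eventually_inf_principal)

lemma bdry_nhds_neq_bot [simp]: "bdry_nhds \<eta> \<noteq> bot"
proof -
  have "\<exists>u. filterlim u (bdry_nhds \<eta>) sequentially"
  proof (cases \<eta>)
    case (Real_Pt x)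
    have "(\<lambda>n. complex_of_real x + \<i> * of_real (inverse (real (Suc n)))) \<longlonglongrightarrow> complex_of_real x + \<i> * of_real 0"
      by (intro tendsto_intros LIMSEQ_inverse_real_of_nat)
    then show ?thesis
      unfolding filterlim_bdry_nhds Real_Pt
      by (intro exI[of _ "\<lambda>n. complex_of_real x + \<i> * of_real (inverse (real (Suc n)))"])
         (auto simp: upper_half_plane_def)
  next
    case Infinity_Pt
    have "filterlim (\<lambda>n. \<i> * of_nat (Suc n) :: complex) at_infinity sequentially"
      by (rule tendsto_mult_filterlim_at_infinity[OF tendsto_const _
            filterlim_compose[OF tendsto_of_nat filterlim_Suc]]) simp
    then show ?thesis
      unfolding filterlim_bdry_nhds Infinity_Pt
      by (intro exI[of _ "\<lambda>n. \<i> * of_nat (Suc n)"]) (auto simp: upper_half_plane_def)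
  qed
  then show ?thesis
    by (auto simp: filterlim_def bot_unique filtermap_bot_iff)
qed

lemma bdry_nhds_unique:
  assumes "filterlim f (bdry_nhds \<eta>) F" "filterlim f (bdry_nhds \<zeta>) F" "F \<noteq> bot"
  shows "\<eta> = \<zeta>"
proof (cases \<eta>)
  case (Real_Pt x)
  then have x: "(f \<longlongrightarrow> complex_of_real x) F"
    using assms(1) by (simp add: filterlim_bdry_nhds)
  show ?thesis
  proof (cases \<zeta>)
    case (Real_Pt y)
    then have "(f \<longlongrightarrow> complex_of_real y) F"
      using assms(2) by (simp add: filterlim_bdry_nhds)
    then show ?thesis
      using tendsto_unique[OF assms(3) x, of "complex_of_real y"] \<open>\<eta> = Real_Pt x\<close> Real_Pt by simp
  next
    case Infinity_Pt
    then show ?thesis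
      using not_tendsto_and_filterlim_at_infinity[OF assms(3) x] assms(2)
      by (simp add: filterlim_bdry_nhds)
  qed
next
  case Infinity_Pt
  then have inf: "filterlim f at_infinity F"
    using assms(1) by (simp add: filterlim_bdry_nhds)
  show ?thesis
  proof (cases \<zeta>)
    case (Real_Pt y)
    then show ?thesis
      using not_tendsto_and_filterlim_at_infinity[OF assms(3) _ inf] assms(2)
      by (auto simp: filterlim_bdry_nhds)
  qed (simp add: Infinity_Pt)
qed

lemma bdry_ext_eqI:
  assumes "filterlim f (bdry_nhds \<eta>) (bdry_nhds \<xi>)"
  shows "bdry_ext f \<xi> = \<eta>"
  unfolding bdry_ext_def
proof (rule the_equality)
  show "\<zeta> = \<eta>" if "filterlim f (bdry_nhds \<zeta>) (bdry_nhds \<xi>)" for \<zeta>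
    using that assms bdry_nhds_neq_bot by (rule bdry_nhds_unique)
qed (rule assms)

lemma basepoint_upper: "\<i> \<in> upper_half_plane"
  by (simp add: upper_half_plane_def)

section \<open>The isometry group\<close>

lemma group_Isom_H2: "group Isom_H2"
proof -
  interpret B: group "BijGroup upper_half_plane" by (rule group_BijGroup)
  let ?C = "carrier Isom_H2"
  have "subgroup ?C (BijGroup upper_half_plane)"
  proof (rule B.subgroupI)
    show "?C \<subseteq> carrier (BijGroup upper_half_plane)"
      by (auto simp: Isom_H2_def BijGroup_def)
    show "?C \<noteq> {}"
      using id_Bij[of upper_half_plane] by (auto simp: Isom_H2_def)
    show "inv\<^bsub>BijGroup upper_half_plane\<^esub> g \<in> ?C" if "g \<in> ?C" for g
    proof -
      have g: "bij_betw g upper_half_plane upper_half_plane" "g \<in> Bij upper_half_plane"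
        using that by (auto simp: Isom_H2_def Bij_def)
      have iso: "hyp_dist (g z) (g w) = hyp_dist z w"
        if "z \<in> upper_half_plane" "w \<in> upper_half_plane" for z w
        using \<open>g \<in> ?C\<close> that by (simp add: Isom_H2_def)
      have inv: "inv_into upper_half_plane g z \<in> upper_half_plane"
        "g (inv_into upper_half_plane g z) = z" if "z \<in> upper_half_plane" for z
        using that g(1) inv_into_into[of z g upper_half_plane] f_inv_into_f[of z g upper_half_plane]
        by (auto simp: bij_betw_def)
      have "hyp_dist (inv_into upper_half_plane g z) (inv_into upper_half_plane g w) = hyp_dist z w"
        if "z \<in> upper_half_plane" "w \<in> upper_half_plane" for z w
        using iso[OF inv(1)[OF that(1)] inv(1)[OF that(2)]] inv(2) that by simp
      then show ?thesis
        using restrict_inv_into_Bij[OF g(2)] by (simp add: inv_BijGroup[OF g(2)] Isom_H2_def)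
    qed
    show "g \<otimes>\<^bsub>BijGroup upper_half_plane\<^esub> h \<in> ?C" if "g \<in> ?C" "h \<in> ?C" for g h
    proof -
      have gh: "g \<in> Bij upper_half_plane" "h \<in> Bij upper_half_plane"
        using that by (auto simp: Isom_H2_def)
      have "h z \<in> upper_half_plane" if "z \<in> upper_half_plane" for z
        using funcset_mem[OF Bij_imp_funcset[OF gh(2)] that] .
      then have "hyp_dist (g (h z)) (g (h w)) = hyp_dist z w"
        if "z \<in> upper_half_plane" "w \<in> upper_half_plane" for z w
        using \<open>g \<in> ?C\<close> \<open>h \<in> ?C\<close> that by (simp add: Isom_H2_def)
      then have "compose upper_half_plane g h \<in> ?C"
        using compose_Bij[OF gh] by (simp add: Isom_H2_def compose_eq)
      then show ?thesis
        using gh by (simp add: BijGroup_def)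
    qed
  qed
  then show ?thesis
    using B.subgroup_imp_group[of ?C] by (simp add: Isom_H2_def)
qed

section \<open>Moebius transformations\<close>

text \<open>
  A Moebius transformation with real coefficients, restricted to the half plane: like the elements of
  \<^const>\<open>Isom_H2\<close>, it is \<open>undefined\<close> outside.
\<close>

definition moebius_map :: "real \<Rightarrow> real \<Rightarrow> real \<Rightarrow> real \<Rightarrow> complex \<Rightarrow> complex" where
  "moebius_map a b c d = (\<lambda>z\<in>upper_half_plane. (of_real a * z + of_real b) / (of_real c * z + of_real d))"

text \<open>The same fraction on \<open>\<real> \<union> {\<infinity>}\<close>, with the value \<open>\<infinity>\<close> where the denominator vanishes.\<close>

definition moebius_bdry :: "real \<Rightarrow> real \<Rightarrow> real \<Rightarrow> real \<Rightarrow> bdry \<Rightarrow> bdry" where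
  "moebius_bdry a b c d \<xi> = (case \<xi> of
     Real_Pt x \<Rightarrow> if c * x + d = 0 then Infinity_Pt else Real_Pt ((a * x + b) / (c * x + d))
   | Infinity_Pt \<Rightarrow> if c = 0 then Infinity_Pt else Real_Pt (a / c))"

text \<open>A matrix in \<open>SL\<^sub>2(\<real>)\<close>; \<open>f\<close> is the isometry that it induces.\<close>

locale unimodular =
  fixes a b c d :: real
  assumes det: "a * d - b * c = 1"
begin

abbreviation f where "f \<equiv> moebius_map a b c d"

lemma denom_nonzero: "z \<in> upper_half_plane \<Longrightarrow> complex_of_real c * z + of_real d \<noteq> 0"
  using det by (auto simp: complex_eq_iff upper_half_plane_def)

lemma Im_moebius_map:
  assumes "z \<in> upper_half_plane"
  shows "Im (f z) = Im z / (cmod (of_real c * z + of_real d))\<^sup>2"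
proof -
  have "Im (f z) = ((c * Re z + d) * (a * Im z) - (a * Re z + b) * (c * Im z))
      / ((c * Re z + d)\<^sup>2 + (c * Im z)\<^sup>2)"
    using assms by (simp add: moebius_map_def Im_divide power2_eq_square algebra_simps)
  also have "(c * Re z + d) * (a * Im z) - (a * Re z + b) * (c * Im z) = (a * d - b * c) * Im z"
    by (simp add: algebra_simps)
  finally show ?thesis by (simp add: det cmod_power2)
qed

lemma moebius_map_in_upper: "z \<in> upper_half_plane \<Longrightarrow> f z \<in> upper_half_plane"
  using Im_moebius_map[of z] denom_nonzero[of z] by (simp add: upper_half_plane_def)

lemma hyp_dist_moebius_map:
  assumes z: "z \<in> upper_half_plane" and w: "w \<in> upper_half_plane"
  shows "hyp_dist (f z) (f w) = hyp_dist z w"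
proof -
  define p where "p = of_real c * z + (of_real d :: complex)"
  define q where "q = of_real c * w + (of_real d :: complex)"
  have nz: "p \<noteq> 0" "q \<noteq> 0" "Im z \<noteq> 0" "Im w \<noteq> 0"
    using denom_nonzero z w by (auto simp: p_def q_def upper_half_plane_def)
  have "f z - f w = ((of_real a * z + of_real b) * q - (of_real a * w + of_real b) * p) / (p * q)"
    using nz z w by (simp add: moebius_map_def p_def[symmetric] q_def[symmetric] diff_frac_eq)
  also have "(of_real a * z + of_real b) * q - (of_real a * w + of_real b) * p = of_real (a * d - b * c) * (z - w)"
    by (simp add: p_def q_def algebra_simps)
  finally have "cmod (f z - f w) = cmod (z - w) / (cmod p * cmod q)"
    by (simp add: det norm_divide norm_mult)
  moreover have "Im (f z) = Im z / (cmod p)\<^sup>2" "Im (f w) = Im w / (cmod q)\<^sup>2"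
    using Im_moebius_map z w by (simp_all add: p_def q_def)
  ultimately have "(cmod (f z - f w))\<^sup>2 / (2 * Im (f z) * Im (f w)) = (cmod (z - w))\<^sup>2 / (2 * Im z * Im w)"
    using nz by (simp add: power_divide power_mult_distrib)
  then show ?thesis
    by (simp add: hyp_dist_def)
qed

lemma moebius_map_holomorphic: "f holomorphic_on upper_half_plane"
proof -
  have "(\<lambda>z. (of_real a * z + of_real b) / (of_real c * z + of_real d)) holomorphic_on upper_half_plane"
    using denom_nonzero by (intro holomorphic_intros) auto
  then show ?thesis
    by (rule holomorphic_transform) (simp add: moebius_map_def)
qed

text \<open>The squared Frobenius norm of the matrix measures the displacement of the basepoint.\<close>

lemma cosh_displacement: "2 * cosh (displacement f) = a\<^sup>2 + b\<^sup>2 + c\<^sup>2 + d\<^sup>2"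
proof -
  have i: "\<i> \<in> upper_half_plane" by (simp add: upper_half_plane_def)
  let ?q = "of_real c * \<i> + of_real d :: complex"
  have q: "?q \<noteq> 0" "(cmod ?q)\<^sup>2 = c\<^sup>2 + d\<^sup>2" "c\<^sup>2 + d\<^sup>2 \<noteq> 0"
    using denom_nonzero[OF i] det by (auto simp: cmod_power2)
  have Im: "Im (f \<i>) = 1 / (c\<^sup>2 + d\<^sup>2)"
    using Im_moebius_map[OF i] q by simp
  have diff: "\<i> - f \<i> = (of_real (- b - c) + \<i> * of_real (d - a)) / ?q"
    using q(1) i by (simp add: moebius_map_def divide_simps algebra_simps)
  have "(cmod (\<i> - f \<i>))\<^sup>2 = ((b + c)\<^sup>2 + (d - a)\<^sup>2) / (c\<^sup>2 + d\<^sup>2)"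
    unfolding diff norm_divide power_divide q(2)
    by (simp add: cmod_power2) (simp add: power2_eq_square algebra_simps)
  then have eq: "1 + (cmod (\<i> - f \<i>))\<^sup>2 / (2 * Im \<i> * Im (f \<i>)) = 1 + ((b + c)\<^sup>2 + (d - a)\<^sup>2) / 2"
    unfolding Im using q(3) by simp
  have "cosh (displacement f) = 1 + ((b + c)\<^sup>2 + (d - a)\<^sup>2) / 2"
    unfolding displacement_def hyp_dist_def eq by (rule cosh_arcosh_real) simp
  then have "2 * cosh (displacement f) = 2 + (b + c)\<^sup>2 + (d - a)\<^sup>2"
    by simp
  also have "\<dots> = a\<^sup>2 + b\<^sup>2 + c\<^sup>2 + d\<^sup>2 + 2 - 2 * (a * d - b * c)"
    by (simp add: power2_eq_square algebra_simps)
  finally show ?thesis by (simp add: det)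
qed

lemma filterlim_moebius_map: "filterlim f (bdry_nhds (moebius_bdry a b c d \<xi>)) (bdry_nhds \<xi>)"
proof -
  let ?F = "bdry_nhds \<xi>"
  let ?m = "\<lambda>z. (of_real a * z + of_real b) / (of_real c * z + of_real d) :: complex"
  have lim: "case \<xi> of
      Real_Pt x \<Rightarrow> ((\<lambda>z. z) \<longlongrightarrow> complex_of_real x) ?F | Infinity_Pt \<Rightarrow> filterlim (\<lambda>z. z) at_infinity ?F"
    using filterlim_ident[of ?F] unfolding filterlim_bdry_nhds by simp
  have upper: "\<forall>\<^sub>F z in ?F. z \<in> upper_half_plane"
    by (rule eventually_bdry_nhds_upper)
  have nz: "\<forall>\<^sub>F z in ?F. complex_of_real c * z + of_real d \<noteq> 0"
    using upper by (rule eventually_mono) (rule denom_nonzero)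
  have "case moebius_bdry a b c d \<xi> of
      Real_Pt y \<Rightarrow> (?m \<longlongrightarrow> complex_of_real y) ?F | Infinity_Pt \<Rightarrow> filterlim ?m at_infinity ?F"
  proof (cases \<xi>)
    case (Real_Pt x)
    then have x: "((\<lambda>z. z) \<longlongrightarrow> complex_of_real x) ?F" using lim by simp
    have num: "((\<lambda>z. of_real a * z + of_real b) \<longlongrightarrow> of_real (a * x + b)) ?F"
      and den: "((\<lambda>z. of_real c * z + of_real d) \<longlongrightarrow> complex_of_real (c * x + d)) ?F"
      by (auto intro!: tendsto_eq_intros x)
    show ?thesis
    proof (cases "c * x + d = 0")
      case False
      then have "(?m \<longlongrightarrow> of_real (a * x + b) / of_real (c * x + d)) ?F"
        by (intro tendsto_divide num den) (simp del: of_real_add of_real_mult)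
      with False show ?thesis by (simp add: Real_Pt moebius_bdry_def)
    next
      case True
      have "a * x + b \<noteq> 0"
      proof
        assume "a * x + b = 0"
        moreover have "a * (c * x + d) - c * (a * x + b) = 1"
          using det by (simp add: algebra_simps)
        ultimately show False using True by simp
      qed
      then have "filterlim ?m at_infinity ?F"
        using den nz by (intro filterlim_divide_at_infinity[OF num])
          (auto simp: filterlim_at True simp del: of_real_add of_real_mult)
      with True show ?thesis by (simp add: Real_Pt moebius_bdry_def)
    qed
  next
    case Infinity_Pt
    then have inf: "filterlim (\<lambda>z. z) at_infinity ?F" using lim by simp
    show ?thesis
    proof (cases "c = 0")
      case True
      then have "a \<noteq> 0" "d \<noteq> 0" using det by auto
      then have "filterlim (\<lambda>z. of_real (a / d) * z + of_real (b / d)) at_infinity ?F"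
        by (intro tendsto_add_filterlim_at_infinity' tendsto_const
            tendsto_mult_filterlim_at_infinity[OF tendsto_const] inf) auto
      with True show ?thesis by (simp add: Infinity_Pt moebius_bdry_def add_divide_distrib)
    next
      case False
      have "filterlim (\<lambda>z. of_real c * z + of_real d :: complex) at_infinity ?F"
        using False by (intro tendsto_add_filterlim_at_infinity' tendsto_const
            tendsto_mult_filterlim_at_infinity[OF tendsto_const] inf) auto
      then have "((\<lambda>z. of_real (a / c) - of_real (1 / c) * inverse (of_real c * z + of_real d)) \<longlongrightarrow>
          complex_of_real (a / c) - of_real (1 / c) * 0) ?F"
        by (intro tendsto_intros filterlim_compose[OF tendsto_inverse_0])
      moreover have "\<forall>\<^sub>F z in ?F. of_real (a / c) - of_real (1 / c) * inverse (of_real c * z + of_real d) = ?m z"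
        using nz
      proof (rule eventually_mono)
        fix z :: complex assume z: "of_real c * z + of_real d \<noteq> 0"
        have "complex_of_real a * of_real d - of_real b * of_real c = 1"
          using det by (metis of_real_1 of_real_diff of_real_mult)
        then have "complex_of_real a * (of_real c * z + of_real d) - 1 = (of_real a * z + of_real b) * of_real c"
          by (simp add: algebra_simps)
        then show "of_real (a / c) - of_real (1 / c) * inverse (of_real c * z + of_real d) = ?m z"
          using z False by (simp add: divide_simps)
      qed
      ultimately show ?thesis
        using False tendsto_cong by (fastforce simp: Infinity_Pt moebius_bdry_def)
    qed
  qed
  moreover have eq: "\<forall>\<^sub>F z in ?F. ?m z = f z"
    using upper by (rule eventually_mono) (simp add: moebius_map_def)
  ultimately have "case moebius_bdry a b c d \<xi> of
      Real_Pt y \<Rightarrow> (f \<longlongrightarrow> complex_of_real y) ?F | Infinity_Pt \<Rightarrow> filterlim f at_infinity ?F"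
    using tendsto_cong[OF eq] filterlim_cong[OF refl refl eq] by (simp split: bdry.splits)
  moreover have "\<forall>\<^sub>F z in ?F. f z \<in> upper_half_plane"
    using upper by (rule eventually_mono) (rule moebius_map_in_upper)
  ultimately show ?thesis
    unfolding filterlim_bdry_nhds by simp
qed

lemma bdry_ext_moebius_map: "bdry_ext f = moebius_bdry a b c d"
  using bdry_ext_eqI[OF filterlim_moebius_map] by blast

text \<open>
  The boundary is the projective line: \<open>\<xi>\<close> is the line spanned by \<open>(sin \<theta>, cos \<theta>)\<close>, where \<open>\<theta>\<close> is the
  arc length parameter, and the matrix acts linearly on such vectors.
\<close>

lemma moebius_bdry_vector:
  fixes \<xi> defines "\<theta> \<equiv> arc_param \<xi>" and "\<phi> \<equiv> arc_param (moebius_bdry a b c d \<xi>)"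
  shows "\<exists>l. a * sin \<theta> + b * cos \<theta> = l * sin \<phi> \<and> c * sin \<theta> + d * cos \<theta> = l * cos \<phi>"
proof -
  let ?S = "a * sin \<theta> + b * cos \<theta>" and ?C = "c * sin \<theta> + d * cos \<theta>"
  have tan: "sin (arctan x) = x * cos (arctan x)" for x
    using tan_arctan[of x] by (simp add: tan_def divide_simps split: if_splits)
  have eq: "moebius_bdry a b c d \<xi> = (if ?C = 0 then Infinity_Pt else Real_Pt (?S / ?C))"
  proof (cases \<xi>)
    case (Real_Pt x)
    have "?S = (a * x + b) * cos \<theta>" "?C = (c * x + d) * cos \<theta>" "cos \<theta> \<noteq> 0"
      by (auto simp: \<theta>_def Real_Pt tan algebra_simps)
    then show ?thesis by (simp add: Real_Pt moebius_bdry_def)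
  next
    case Infinity_Pt
    then show ?thesis by (simp add: \<theta>_def moebius_bdry_def)
  qed
  show ?thesis
  proof (cases "?C = 0")
    case True
    then have \<phi>: "\<phi> = pi / 2" by (simp add: \<phi>_def eq)
    show ?thesis
      unfolding \<phi> using True by (intro exI[of _ ?S]) simp
  next
    case False
    then have \<phi>: "\<phi> = arctan (?S / ?C)" by (simp add: \<phi>_def eq)
    have "cos \<phi> \<noteq> 0" "sin \<phi> = ?S / ?C * cos \<phi>"
      unfolding \<phi> by (simp_all only: tan cos_arctan_not_zero not_False_eq_True)
    then show ?thesis
      using False by (intro exI[of _ "?C / cos \<phi>"]) simp
  qed
qed

text \<open>
  A matrix of determinant \<open>1\<close> preserves the area \<open>sin (\<theta> - \<theta>')\<close> spanned by two unit vectors, and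
  shrinks lengths at most by the Frobenius norm of its inverse, which is that of the matrix itself.
\<close>

lemma dist_moebius_bdry_le:
  "dist (moebius_bdry a b c d \<xi>) (moebius_bdry a b c d \<eta>) \<le> 4 * cosh (displacement f) * dist \<xi> \<eta>"
proof -
  define m where "m = a\<^sup>2 + b\<^sup>2 + c\<^sup>2 + d\<^sup>2"
  define \<theta> where "\<theta> \<zeta> = arc_param \<zeta>" for \<zeta>
  define \<phi> where "\<phi> \<zeta> = arc_param (moebius_bdry a b c d \<zeta>)" for \<zeta>
  have "\<forall>\<zeta>. \<exists>l. a * sin (\<theta> \<zeta>) + b * cos (\<theta> \<zeta>) = l * sin (\<phi> \<zeta>)
      \<and> c * sin (\<theta> \<zeta>) + d * cos (\<theta> \<zeta>) = l * cos (\<phi> \<zeta>)"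
    unfolding \<theta>_def \<phi>_def using moebius_bdry_vector by blast
  then obtain l where l: "\<And>\<zeta>. a * sin (\<theta> \<zeta>) + b * cos (\<theta> \<zeta>) = l \<zeta> * sin (\<phi> \<zeta>)"
      "\<And>\<zeta>. c * sin (\<theta> \<zeta>) + d * cos (\<theta> \<zeta>) = l \<zeta> * cos (\<phi> \<zeta>)"
    by metis
  have norm: "1 \<le> m * (l \<zeta>)\<^sup>2" for \<zeta>
  proof -
    let ?S = "a * sin (\<theta> \<zeta>) + b * cos (\<theta> \<zeta>)" and ?C = "c * sin (\<theta> \<zeta>) + d * cos (\<theta> \<zeta>)"
    have "d * ?S - b * ?C = (a * d - b * c) * sin (\<theta> \<zeta>)"
      "a * ?C - c * ?S = (a * d - b * c) * cos (\<theta> \<zeta>)"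
      by (simp_all add: algebra_simps)
    then have "1 = (d * ?S - b * ?C)\<^sup>2 + (a * ?C - c * ?S)\<^sup>2"
      by (simp add: det)
    \<comment> \<open>The added squares complete both terms to Lagrange's identity.\<close>
    also have "\<dots> \<le> (d * ?S - b * ?C)\<^sup>2 + (a * ?C - c * ?S)\<^sup>2
        + (d * ?C + b * ?S)\<^sup>2 + (a * ?S + c * ?C)\<^sup>2"
      by simp
    also have "\<dots> = m * (?S\<^sup>2 + ?C\<^sup>2)"
      unfolding m_def by algebra
    also have "?S\<^sup>2 + ?C\<^sup>2 = (l \<zeta>)\<^sup>2 * ((sin (\<phi> \<zeta>))\<^sup>2 + (cos (\<phi> \<zeta>))\<^sup>2)"
      unfolding l by algebra
    finally show ?thesis by simp
  qed
  have "l \<xi> * l \<eta> * sin (\<phi> \<xi> - \<phi> \<eta>)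
      = (l \<xi> * sin (\<phi> \<xi>)) * (l \<eta> * cos (\<phi> \<eta>)) - (l \<xi> * cos (\<phi> \<xi>)) * (l \<eta> * sin (\<phi> \<eta>))"
    by (simp add: sin_diff algebra_simps)
  also have "\<dots> = (a * d - b * c) * sin (\<theta> \<xi> - \<theta> \<eta>)"
    unfolding l[symmetric] by (simp add: sin_diff algebra_simps)
  finally have det_eq: "l \<xi> * l \<eta> * sin (\<phi> \<xi> - \<phi> \<eta>) = sin (\<theta> \<xi> - \<theta> \<eta>)"
    by (simp add: det)
  have "1 * 1 \<le> (m * (l \<xi>)\<^sup>2) * (m * (l \<eta>)\<^sup>2)"
    by (intro mult_mono norm) (auto simp: m_def)
  then have "1\<^sup>2 \<le> (m * \<bar>l \<xi> * l \<eta>\<bar>)\<^sup>2"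
    by (simp add: power_mult_distrib algebra_simps power2_eq_square)
  then have "1 \<le> m * \<bar>l \<xi> * l \<eta>\<bar>"
    by (rule power2_le_imp_le) (simp add: m_def)
  then have "1 * \<bar>sin (\<phi> \<xi> - \<phi> \<eta>)\<bar> \<le> m * \<bar>l \<xi> * l \<eta>\<bar> * \<bar>sin (\<phi> \<xi> - \<phi> \<eta>)\<bar>"
    by (intro mult_right_mono) auto
  then have "\<bar>sin (\<phi> \<xi> - \<phi> \<eta>)\<bar> \<le> m * \<bar>sin (\<theta> \<xi> - \<theta> \<eta>)\<bar>"
    unfolding det_eq[symmetric] by (simp add: abs_mult mult.assoc)
  then have "sin (dist (moebius_bdry a b c d \<xi>) (moebius_bdry a b c d \<eta>)) \<le> m * sin (dist \<xi> \<eta>)"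
    by (simp add: sin_dist_bdry \<phi>_def \<theta>_def)
  moreover have "m * sin (dist \<xi> \<eta>) \<le> m * dist \<xi> \<eta>"
    by (intro mult_left_mono sin_x_le_x) (auto simp: m_def)
  ultimately have "dist (moebius_bdry a b c d \<xi>) (moebius_bdry a b c d \<eta>) \<le> 2 * m * dist \<xi> \<eta>"
    using dist_bdry_le_sin[of "moebius_bdry a b c d \<xi>" "moebius_bdry a b c d \<eta>"] by linarith
  moreover have "2 * m = 4 * cosh (displacement f)"
    using cosh_displacement by (simp add: m_def)
  ultimately show ?thesis by simp
qed

end

lemma compose_moebius_map:
  assumes "unimodular a b c d" "unimodular a' b' c' d'"
  shows "compose upper_half_plane (moebius_map a b c d) (moebius_map a' b' c' d')
    = moebius_map (a * a' + b * c') (a * b' + b * d') (c * a' + d * c') (c * b' + d * d')"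
proof
  fix z
  show "compose upper_half_plane (moebius_map a b c d) (moebius_map a' b' c' d') z
    = moebius_map (a * a' + b * c') (a * b' + b * d') (c * a' + d * c') (c * b' + d * d') z"
  proof (cases "z \<in> upper_half_plane")
    case True
    define N where "N = of_real a' * z + (of_real b' :: complex)"
    define D where "D = of_real c' * z + (of_real d' :: complex)"
    have D: "D \<noteq> 0"
      using unimodular.denom_nonzero[OF assms(2) True] by (simp add: D_def)
    have "compose upper_half_plane (moebius_map a b c d) (moebius_map a' b' c' d') z
        = (of_real a * (N / D) + of_real b) / (of_real c * (N / D) + of_real d)"
      using True unimodular.moebius_map_in_upper[OF assms(2) True]
      by (simp add: compose_def moebius_map_def N_def D_def)
    also have "\<dots> = ((of_real a * (N / D) + of_real b) * D) / ((of_real c * (N / D) + of_real d) * D)"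
      using D by simp
    also have "\<dots> = (of_real a * N + of_real b * D) / (of_real c * N + of_real d * D)"
      using D by (simp add: distrib_right)
    finally show ?thesis
      using True by (simp add: moebius_map_def N_def D_def algebra_simps)
  qed (simp add: compose_def moebius_map_def)
qed

section \<open>The modular group\<close>

text \<open>The group \<open>PSL\<^sub>2(\<int>)\<close>, as a set of functions.\<close>

definition modular_group :: "(complex \<Rightarrow> complex) set" where
  "modular_group = {moebius_map a b c d | a b c d. unimodular a b c d \<and> {a, b, c, d} \<subseteq> \<int>}"

lemma modular_groupE:
  assumes "g \<in> modular_group"
  obtains a b c d where "unimodular a b c d" "{a, b, c, d} \<subseteq> \<int>" "g = moebius_map a b c d"
  using assms unfolding modular_group_def by blast

lemma modular_group_in_upper:
  "g \<in> modular_group \<Longrightarrow> z \<in> upper_half_plane \<Longrightarrow> g z \<in> upper_half_plane"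
  by (auto elim!: modular_groupE simp: unimodular.moebius_map_in_upper)

lemma compose_modular_group:
  assumes "g \<in> modular_group" "h \<in> modular_group"
  shows "compose upper_half_plane g h \<in> modular_group"
proof -
  obtain a b c d where g: "unimodular a b c d" "{a, b, c, d} \<subseteq> \<int>" "g = moebius_map a b c d"
    using assms(1) by (rule modular_groupE)
  obtain a' b' c' d' where h: "unimodular a' b' c' d'" "{a', b', c', d'} \<subseteq> \<int>" "h = moebius_map a' b' c' d'"
    using assms(2) by (rule modular_groupE)
  have "(a * a' + b * c') * (c * b' + d * d') - (a * b' + b * d') * (c * a' + d * c')
      = (a * d - b * c) * (a' * d' - b' * c')"
    by algebra
  then have "unimodular (a * a' + b * c') (a * b' + b * d') (c * a' + d * c') (c * b' + d * d')"
    using g(1) h(1) by (simp add: unimodular_def)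
  then show ?thesis
    using g h compose_moebius_map[OF g(1) h(1)] unfolding modular_group_def by fastforce
qed

lemma filterlim_bdry_ext:
  "g \<in> modular_group \<Longrightarrow> filterlim g (bdry_nhds (bdry_ext g \<xi>)) (bdry_nhds \<xi>)"
  by (auto elim!: modular_groupE simp: unimodular.bdry_ext_moebius_map
      intro!: unimodular.filterlim_moebius_map)

lemma dist_bdry_ext_le:
  "g \<in> modular_group \<Longrightarrow> dist (bdry_ext g \<xi>) (bdry_ext g \<eta>) \<le> 4 * cosh (displacement g) * dist \<xi> \<eta>"
  by (auto elim!: modular_groupE simp: unimodular.bdry_ext_moebius_map
      intro!: unimodular.dist_moebius_bdry_le)

lemma bdry_ext_left_inverse:
  assumes "g \<in> modular_group" "h \<in> modular_group"
    and inv: "\<And>z. z \<in> upper_half_plane \<Longrightarrow> h (g z) = z"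
  shows "bdry_ext h (bdry_ext g \<xi>) = \<xi>"
proof (rule bdry_nhds_unique)
  show "filterlim (\<lambda>z. h (g z)) (bdry_nhds (bdry_ext h (bdry_ext g \<xi>))) (bdry_nhds \<xi>)"
    using assms(1,2) by (intro filterlim_compose[OF filterlim_bdry_ext filterlim_bdry_ext])
  have "\<forall>\<^sub>F z in bdry_nhds \<xi>. h (g z) = z"
    using eventually_bdry_nhds_upper by (rule eventually_mono) (rule inv)
  then show "filterlim (\<lambda>z. h (g z)) (bdry_nhds \<xi>) (bdry_nhds \<xi>)"
    by (subst filterlim_cong[OF refl refl]) (auto intro: filterlim_ident)
qed simp

lemma displacement_left_inverse:
  assumes "g \<in> modular_group" "h \<in> modular_group"
    and inv: "\<And>z. z \<in> upper_half_plane \<Longrightarrow> h (g z) = z"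
  shows "displacement h = displacement g"
proof -
  note i = basepoint_upper
  have "g \<i> \<in> upper_half_plane"
    using assms(1) i by (rule modular_group_in_upper)
  then have "hyp_dist (h \<i>) (h (g \<i>)) = hyp_dist \<i> (g \<i>)"
    using assms(2) i by (auto elim!: modular_groupE simp: unimodular.hyp_dist_moebius_map)
  moreover have "hyp_dist (h \<i>) \<i> = hyp_dist \<i> (h \<i>)"
    by (simp add: hyp_dist_def norm_minus_commute mult.commute)
  ultimately show ?thesis
    by (simp add: displacement_def inv i)
qed

lemma modular_group_displacement_subset:
  "{g \<in> modular_group. 2 * cosh (displacement g) \<le> (real K)\<^sup>2}
     \<subseteq> (\<lambda>(a, b, c, d). moebius_map (of_int a) (of_int b) (of_int c) (of_int d)) `
        ({- int K..int K} \<times> {- int K..int K} \<times> {- int K..int K} \<times> {- int K..int K})"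
proof
  fix g assume "g \<in> {g \<in> modular_group. 2 * cosh (displacement g) \<le> (real K)\<^sup>2}"
  then have g: "g \<in> modular_group" "2 * cosh (displacement g) \<le> (real K)\<^sup>2" by auto
  obtain a b c d where u: "unimodular a b c d" "{a, b, c, d} \<subseteq> \<int>" and eq: "g = moebius_map a b c d"
    using g(1) by (rule modular_groupE)
  have sum: "a\<^sup>2 + b\<^sup>2 + c\<^sup>2 + d\<^sup>2 \<le> (real K)\<^sup>2"
    using g(2) unimodular.cosh_displacement[OF u(1)] by (simp add: eq)
  have range: "\<exists>n\<in>{- int K..int K}. x = of_int n" if "x\<^sup>2 \<le> (real K)\<^sup>2" "x \<in> \<int>" for x
  proof -
    obtain n where n: "x = of_int n" using \<open>x \<in> \<int>\<close> by (rule Ints_cases)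
    have "\<bar>x\<bar> \<le> real K" using that(1) by (rule power2_le_imp_le[of "\<bar>x\<bar>", simplified]) simp
    then show ?thesis using n by (intro bexI[of _ n]) (auto simp: abs_le_iff)
  qed
  have "0 \<le> a\<^sup>2" "0 \<le> b\<^sup>2" "0 \<le> c\<^sup>2" "0 \<le> d\<^sup>2" by simp_all
  then have "a\<^sup>2 \<le> (real K)\<^sup>2" "b\<^sup>2 \<le> (real K)\<^sup>2" "c\<^sup>2 \<le> (real K)\<^sup>2" "d\<^sup>2 \<le> (real K)\<^sup>2"
    using sum by linarith+
  then obtain a' b' c' d' where "a = of_int a'" "b = of_int b'" "c = of_int c'" "d = of_int d'"
      and "{a', b', c', d'} \<subseteq> {- int K..int K}"
    using range u(2) by (metis empty_subsetI insert_subset)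
  then show "g \<in> (\<lambda>(a, b, c, d). moebius_map (of_int a) (of_int b) (of_int c) (of_int d)) `
        ({- int K..int K} \<times> {- int K..int K} \<times> {- int K..int K} \<times> {- int K..int K})"
    unfolding eq by (intro image_eqI[of _ _ "(a', b', c', d')"]) auto
qed

lemma finite_modular_group_displacement:
  "finite {g \<in> modular_group. 2 * cosh (displacement g) \<le> (real K)\<^sup>2}"
  by (rule finite_subset[OF modular_group_displacement_subset]) auto

lemma card_modular_group_displacement:
  "card {g \<in> modular_group. 2 * cosh (displacement g) \<le> (real K)\<^sup>2} \<le> (2 * K + 1) ^ 4"
proof -
  let ?I = "{- int K..int K}"
  have "card {g \<in> modular_group. 2 * cosh (displacement g) \<le> (real K)\<^sup>2} \<le> card (?I \<times> ?I \<times> ?I \<times> ?I)"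
    by (rule surj_card_le[OF _ modular_group_displacement_subset]) auto
  also have "card ?I = 2 * K + 1" by simp
  then have "card (?I \<times> ?I \<times> ?I \<times> ?I) = (2 * K + 1) ^ 4"
    by (simp only: card_cartesian_product power4_eq_xxxx mult.assoc)
  finally show ?thesis .
qed

lemma discrete_subset_modular_group:
  assumes "G \<subseteq> modular_group"
  shows "discrete G"
proof (rule discreteI)
  fix g assume g: "g \<in> G"
  have "g \<i> \<in> upper_half_plane"
    using g assms by (auto intro: modular_group_in_upper basepoint_upper)
  then have Im: "Im (g \<i>) > 0" by (simp add: upper_half_plane_def)
  define V where "V = {w. Im (g \<i>) / 2 < Im w} \<inter> ball (g \<i>) 1"
  have V: "open V" "g \<i> \<in> V"
    using Im by (auto simp: V_def intro!: open_Int open_Collect_less continuous_intros)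
  define M where "M = 2 + (cmod (\<i> - g \<i>) + 1)\<^sup>2 * 2 / Im (g \<i>)"
  have M: "2 * cosh (displacement h) \<le> M" if "h \<i> \<in> V" for h
  proof -
    have Im': "Im (h \<i>) > Im (g \<i>) / 2" "Im (h \<i>) > 0"
      using that Im by (auto simp: V_def)
    have "cmod (\<i> - h \<i>) \<le> cmod (\<i> - g \<i>) + 1"
      using that norm_triangle_ineq[of "\<i> - g \<i>" "g \<i> - h \<i>"] by (simp add: V_def dist_norm)
    then have "(cmod (\<i> - h \<i>))\<^sup>2 / Im (h \<i>) \<le> (cmod (\<i> - g \<i>) + 1)\<^sup>2 / (Im (g \<i>) / 2)"
      using Im Im' by (intro frac_le power_mono) auto
    moreover have "cosh (displacement h) = 1 + (cmod (\<i> - h \<i>))\<^sup>2 / (2 * Im \<i> * Im (h \<i>))"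
      unfolding displacement_def hyp_dist_def using Im' by (intro cosh_arcosh_real) simp
    ultimately show ?thesis by (simp add: M_def)
  qed
  obtain K :: nat where K: "max M 1 \<le> real K"
    using real_arch_simple by blast
  then have "real K * 1 \<le> real K * real K" "M \<le> real K"
    by (auto intro!: mult_left_mono)
  then have "M \<le> (real K)\<^sup>2"
    unfolding power2_eq_square by linarith
  then have "{h \<in> G. h \<i> \<in> V} \<subseteq> {h \<in> modular_group. 2 * cosh (displacement h) \<le> (real K)\<^sup>2}"
    using M assms by (force intro: order_trans)
  then have fin: "finite ({h \<in> G. h \<i> \<in> V} - {g})"
    using finite_modular_group_displacement finite_subset by blast
  have "\<exists>z. g z \<noteq> h z" if "h \<noteq> g" for h
    using that by (metis ext)
  then obtain p where p: "\<And>h. h \<noteq> g \<Longrightarrow> g (p h) \<noteq> h (p h)" by metis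
  \<comment> \<open>Near \<open>g\<close> only finitely many elements of \<open>G\<close> remain; each is excluded by its value at one point.\<close>
  define T where "T = {f. f \<i> \<in> V} \<inter> (\<Inter>h\<in>{h \<in> G. h \<i> \<in> V} - {g}. {f. f (p h) \<in> - {h (p h)}})"
  have cylinder: "open {f :: complex \<Rightarrow> complex. f z \<in> U}" if "open U" for z U
    using open_vimage[OF that continuous_on_product_coordinates[of z]] by (simp add: vimage_def)
  then have "open T"
    unfolding T_def using V(1) fin by (intro open_Int open_INT ballI cylinder) auto
  moreover have "T \<inter> G = {g}"
    using g V p by (auto simp: T_def)
  ultimately show "g isolated_in G"
    using g unfolding isolated_in_def by blast
qed

section \<open>Involutions exchanging the inside and the outside of disjoint discs\<close>

text \<open>
  The disc number \<open>j\<close> has centre \<open>2j + A/(A\<^sup>2 + 1)\<close> and radius \<open>1/(A\<^sup>2 + 1)\<close>, where \<open>A = 2\<^bsup>j^2\<^esup>\<close>. It lies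
  over the interval \<open>[2j, 2j + 1]\<close>, whence the discs are disjoint and tend to infinity slowly, whereas
  their radii decay faster than exponentially. The involution in disc \<open>j\<close> is the conjugate by
  \<open>z \<mapsto> z + 2j\<close> of the one with the integer matrix \<open>(A, -1; A\<^sup>2 + 1, -A)\<close> of determinant \<open>1\<close>.
\<close>

definition scale :: "nat \<Rightarrow> real" where
  "scale j = 2 ^ (j ^ 2)"

definition rad :: "nat \<Rightarrow> real" where
  "rad j = 1 / (scale j ^ 2 + 1)"

definition ctr :: "nat \<Rightarrow> real" where
  "ctr j = 2 * real j + scale j * rad j"

definition disc :: "nat \<Rightarrow> complex set" where
  "disc j = cball (of_real (ctr j)) (rad j)"

lemma rad_pos: "rad j > 0"
  by (simp add: rad_def add_nonneg_pos)

lemma ctr_bounds: "2 * real j \<le> ctr j - rad j" "ctr j + rad j \<le> 2 * real j + 1"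
proof -
  have s: "scale j \<ge> 1" by (simp add: scale_def)
  have "rad j * 1 \<le> rad j * scale j"
    using s rad_pos[of j] by (intro mult_left_mono) auto
  then show "2 * real j \<le> ctr j - rad j" by (simp add: ctr_def mult.commute)
  have "scale j * 1 \<le> scale j * scale j" using s by (intro mult_left_mono) auto
  then have "(scale j + 1) / (scale j ^ 2 + 1) \<le> 1"
    by (simp add: divide_le_eq add_nonneg_pos power2_eq_square)
  then show "ctr j + rad j \<le> 2 * real j + 1"
    by (simp add: ctr_def rad_def add_divide_distrib)
qed

lemma disc_Re: "z \<in> disc j \<Longrightarrow> 2 * real j \<le> Re z \<and> Re z \<le> 2 * real j + 1"
  using abs_Re_le_cmod[of "of_real (ctr j) - z"] ctr_bounds[of j]
  by (auto simp: disc_def dist_norm)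

lemma disc_disjoint: "z \<in> disc j \<Longrightarrow> z \<in> disc k \<Longrightarrow> j = k"
  using disc_Re[of z j] disc_Re[of z k] by linarith

lemma basepoint_notin_disc: "\<i> \<notin> disc j"
proof
  assume "\<i> \<in> disc j"
  then have "\<bar>Im (of_real (ctr j) - \<i>)\<bar> \<le> rad j"
    using abs_Im_le_cmod[of "of_real (ctr j) - \<i>"] by (simp add: disc_def dist_norm)
  moreover have "rad j \<le> 1 / 2"
    using ctr_bounds[of j] by linarith
  ultimately show False by simp
qed

text \<open>The inversion in the boundary circle of the disc, composed with the reflection in the
  vertical line through its centre.\<close>

definition involution :: "nat \<Rightarrow> complex \<Rightarrow> complex" where
  "involution j = (\<lambda>z\<in>upper_half_plane. of_real (ctr j) - of_real ((rad j)\<^sup>2) / (z - of_real (ctr j)))"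

lemma upper_neq_of_real: "z \<in> upper_half_plane \<Longrightarrow> z \<noteq> of_real x"
  by (auto simp: upper_half_plane_def)

lemma involution_modular_group: "involution j \<in> modular_group"
proof -
  define A :: int where "A = 2 ^ (j ^ 2)"
  define n where "n = 2 * int j"
  define q where "q = A\<^sup>2 + 1"
  define p where "p = A + n * q"
  define b where "b = - (1 + 2 * A * n + n\<^sup>2 * q)"
  have det: "p * - p - b * q = 1"
    unfolding p_def b_def q_def by (simp add: power2_eq_square algebra_simps)
  have q: "q > 0" by (simp add: q_def add_nonneg_pos)
  have A: "scale j = of_int A" by (simp add: scale_def A_def)
  have rad: "rad j = 1 / of_int q"
    by (simp add: rad_def A q_def)
  have ctr: "ctr j = of_int p / of_int q"
    using q by (simp add: ctr_def rad A p_def n_def add_divide_distrib)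
  have "involution j z = moebius_map p b q (- p) z" for z
  proof (cases "z \<in> upper_half_plane")
    case True
    define Q where "Q = (of_int q :: complex)"
    define P where "P = (of_int p :: complex)"
    have nz: "Q \<noteq> 0" using q by (simp add: Q_def)
    have "z \<noteq> P / Q"
      using upper_neq_of_real[OF True, of "of_int p / of_int q"] by (simp add: P_def Q_def)
    then have D: "Q * z - P \<noteq> 0"
      using nz by (auto simp: field_simps)
    have B: "of_int b * Q = - (P * P) - 1"
    proof -
      have "b * q = - (p * p) - 1" using det by simp
      then have "complex_of_int (b * q) = of_int (- (p * p) - 1)" by simp
      then show ?thesis by (simp add: P_def Q_def)
    qed
    have "involution j z = P / Q - 1 / (Q * (Q * z - P))"
      using True nz D
      by (simp add: involution_def ctr rad P_def[symmetric] Q_def[symmetric] power2_eq_square field_simps)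
    also have "\<dots> = ((P * z + of_int b) * Q) / (Q * (Q * z - P))"
      using nz D by (simp add: divide_simps B distrib_right) (simp add: algebra_simps)
    also have "\<dots> = (P * z + of_int b) / (Q * z - P)"
      using nz by simp
    finally show ?thesis
      using True by (simp add: moebius_map_def P_def Q_def)
  qed (simp add: involution_def moebius_map_def)
  moreover have "unimodular p b q (- p)"
    using arg_cong[OF det, of real_of_int] by unfold_locales simp
  ultimately show ?thesis
    unfolding modular_group_def by (auto intro!: exI ext)
qed

lemma involution_in_upper: "z \<in> upper_half_plane \<Longrightarrow> involution j z \<in> upper_half_plane"
  by (rule modular_groupE[OF involution_modular_group[of j]])
     (simp add: unimodular.moebius_map_in_upper)

lemma involution_involution: "z \<in> upper_half_plane \<Longrightarrow> involution j (involution j z) = z"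
  using involution_in_upper[of z j] upper_neq_of_real[of z "ctr j"] rad_pos[of j]
  by (simp add: involution_def)

lemma involution_in_disc:
  assumes "z \<in> upper_half_plane" "z \<notin> disc j"
  shows "involution j z \<in> disc j"
proof -
  have r: "rad j < cmod (z - of_real (ctr j))"
    using assms(2) by (simp add: disc_def dist_norm norm_minus_commute)
  have "cmod (of_real (ctr j) - involution j z) = cmod (of_real ((rad j)\<^sup>2) / (z - of_real (ctr j)))"
    using assms(1) by (simp add: involution_def)
  also have "\<dots> = rad j * (rad j / cmod (z - of_real (ctr j)))"
    by (simp only: norm_divide norm_of_real abs_power2) (simp add: power2_eq_square)
  also have "\<dots> \<le> rad j * 1"
  proof (rule mult_left_mono)
    show "rad j / cmod (z - of_real (ctr j)) \<le> 1"
      using r rad_pos[of j] by (subst divide_le_eq_1_pos) linarith+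
  qed (use rad_pos[of j] in simp)
  finally show ?thesis by (simp add: disc_def dist_norm)
qed

text \<open>
  The group generated by the involutions, as the set of all words in the generators; inverse letters
  are not needed.
\<close>

fun word :: "nat list \<Rightarrow> complex \<Rightarrow> complex" where
  "word [] = (\<lambda>z\<in>upper_half_plane. z)"
| "word (j # l) = compose upper_half_plane (involution j) (word l)"

definition involution_group :: "(complex \<Rightarrow> complex) set" where
  "involution_group = range word"

lemma word_modular_group: "word l \<in> modular_group"
proof (induction l)
  case Nil
  have "unimodular 1 0 0 1" "word [] = moebius_map 1 0 0 1"
    by (auto simp: unimodular_def moebius_map_def)
  then show ?case
    unfolding modular_group_def by (intro CollectI exI conjI) auto
next
  case (Cons j l)
  then show ?case
    using compose_modular_group[OF involution_modular_group] by simp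
qed

lemma involution_group_subset: "involution_group \<subseteq> modular_group"
  using word_modular_group by (auto simp: involution_group_def)

lemma word_in_upper: "z \<in> upper_half_plane \<Longrightarrow> word l z \<in> upper_half_plane"
  by (induction l) (auto simp: compose_def involution_in_upper)

lemma word_append: "z \<in> upper_half_plane \<Longrightarrow> word (l @ l') z = word l (word l' z)"
  by (induction l) (auto simp: compose_def word_in_upper)

lemma word_rev: "z \<in> upper_half_plane \<Longrightarrow> word (rev l) (word l z) = z"
  by (induction l arbitrary: z) (auto simp: compose_def word_append word_in_upper
      involution_in_upper involution_involution)

lemma word_extensional: "word l \<in> extensional upper_half_plane"
  by (cases l) (auto simp: compose_def)

lemma compose_word: "compose upper_half_plane (word l) (word l') = word (l @ l')"
  by (rule extensionalityI[OF compose_extensional word_extensional])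
     (simp add: compose_def word_append)

lemma compose_involution_group:
  "g \<in> involution_group \<Longrightarrow> h \<in> involution_group \<Longrightarrow>
    compose upper_half_plane g h \<in> involution_group"
  by (auto simp: involution_group_def compose_word)

lemma word_in_carrier: "word l \<in> carrier Isom_H2"
proof -
  have "bij_betw (word l) upper_half_plane upper_half_plane"
    using word_rev[of _ l] word_rev[of _ "rev l"] word_in_upper
    by (intro bij_betw_byWitness[where f' = "word (rev l)"]) auto
  moreover have "hyp_dist (word l z) (word l w) = hyp_dist z w"
    if "z \<in> upper_half_plane" "w \<in> upper_half_plane" for z w
    using word_modular_group[of l] that
    by (auto elim!: modular_groupE simp: unimodular.hyp_dist_moebius_map)
  ultimately show ?thesis
    using word_extensional by (simp add: Isom_H2_def Bij_def)
qed

lemma involution_group_inverse: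
  assumes "g \<in> involution_group"
  obtains h where "h \<in> involution_group" "\<And>z. z \<in> upper_half_plane \<Longrightarrow> h (g z) = z"
    "\<And>z. z \<in> upper_half_plane \<Longrightarrow> g (h z) = z"
proof -
  obtain l where l: "g = word l" using assms by (auto simp: involution_group_def)
  show ?thesis
    using that[of "word (rev l)"] word_rev[of _ l] word_rev[of _ "rev l"]
    by (simp add: l involution_group_def)
qed

lemma subgroup_involution_group: "subgroup involution_group Isom_H2"
proof -
  interpret I: group Isom_H2 by (rule group_Isom_H2)
  have mult: "word l \<otimes>\<^bsub>Isom_H2\<^esub> word l' = word (l @ l')" for l l'
    using word_in_carrier[of l] word_in_carrier[of l']
    by (simp add: Isom_H2_def BijGroup_def compose_word)
  have one: "\<one>\<^bsub>Isom_H2\<^esub> = word []"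
    by (simp add: Isom_H2_def BijGroup_def)
  have inv: "inv\<^bsub>Isom_H2\<^esub> (word l) = word (rev l)" for l
  proof -
    have "word (rev l @ l) = word []" for l
      by (rule extensionalityI[OF word_extensional word_extensional]) (simp add: word_append word_rev)
    then have "word (rev l) \<otimes>\<^bsub>Isom_H2\<^esub> word l = \<one>\<^bsub>Isom_H2\<^esub>"
      by (simp only: mult one)
    then show ?thesis
      by (rule I.inv_equality) (rule word_in_carrier)+
  qed
  show ?thesis
  proof
    show "involution_group \<subseteq> carrier Isom_H2"
      using word_in_carrier by (auto simp: involution_group_def)
    show "\<one>\<^bsub>Isom_H2\<^esub> \<in> involution_group"
      by (simp only: one involution_group_def rangeI)
    show "g \<otimes>\<^bsub>Isom_H2\<^esub> h \<in> involution_group" if "g \<in> involution_group" "h \<in> involution_group" for g h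
      using that mult by (auto simp: involution_group_def)
    show "inv\<^bsub>Isom_H2\<^esub> g \<in> involution_group" if "g \<in> involution_group" for g
      using that inv by (auto simp: involution_group_def)
  qed
qed

lemma fuchsian_involution_group: "fuchsian_group involution_group"
  unfolding fuchsian_group_def
  using subgroup_involution_group discrete_subset_modular_group[OF involution_group_subset]
    involution_group_subset
  by (auto elim!: modular_groupE intro!: unimodular.moebius_map_holomorphic)

section \<open>The limit set\<close>

lemma word_eq_reduced: "\<exists>l'. word l = word l' \<and> distinct_adj l'"
proof (induction l)
  case Nil
  then show ?case by (intro exI[of _ "[]"]) simp
next
  case (Cons j l)
  then obtain l' where l': "word l = word l'" "distinct_adj l'" by blast
  show ?case
  proof (cases "\<exists>l''. l' = j # l''")
    case True
    then obtain l'' where l'': "l' = j # l''" by blast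
    have "word (j # l) = word l''"
      by (rule extensionalityI[OF word_extensional word_extensional])
         (simp add: l' l'' compose_def involution_involution word_in_upper)
    moreover have "distinct_adj l''" using l'(2) l'' by (cases l'') auto
    ultimately show ?thesis by blast
  next
    case False
    then have "distinct_adj (j # l')" using l'(2) by (cases l') auto
    then show ?thesis using l'(1) by (intro exI[of _ "j # l'"]) simp
  qed
qed

text \<open>
  Ping-pong: the basepoint lies outside all discs, and the generator \<open>j\<close> maps the other discs
  into disc \<open>j\<close>.
\<close>

lemma reduced_word_in_disc:
  "distinct_adj (j # l) \<Longrightarrow> word (j # l) \<i> \<in> disc j"
proof (induction l arbitrary: j)
  case Nil
  then show ?case by (simp add: compose_def basepoint_upper involution_in_disc basepoint_notin_disc)
next
  case (Cons k l)
  then have "word (k # l) \<i> \<in> disc k" "k \<noteq> j" by auto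
  then have "word (k # l) \<i> \<notin> disc j" using disc_disjoint by blast
  then have "involution j (word (k # l) \<i>) \<in> disc j"
    by (rule involution_in_disc[OF word_in_upper[OF basepoint_upper]])
  then show ?case by (simp add: compose_def basepoint_upper)
qed

lemma involution_group_basepoint:
  assumes "g \<in> involution_group"
  shows "g \<i> = \<i> \<or> (\<exists>j. g \<i> \<in> disc j)"
proof -
  obtain l where l: "g = word l" "distinct_adj l"
    using assms word_eq_reduced by (auto simp: involution_group_def)
  then show ?thesis
    using reduced_word_in_disc by (cases l) (auto simp: basepoint_upper simp del: word.simps(2))
qed

text \<open>The trace of disc \<open>j\<close> on the boundary.\<close>

definition disc_arc :: "nat \<Rightarrow> bdry set" where
  "disc_arc j = Real_Pt ` {ctr j - rad j..ctr j + rad j}"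

text \<open>
  The discs are locally finite in the plane, so a finite limit point, being a limit of points of the
  discs, lies in one of the closed discs.
\<close>

lemma limit_set_involution_group_subset:
  "limit_set involution_group \<subseteq> insert Infinity_Pt (\<Union>j. disc_arc j)"
proof
  fix \<eta> assume "\<eta> \<in> limit_set involution_group"
  then obtain g where g: "range g \<subseteq> involution_group"
      "filterlim (\<lambda>n::nat. g n \<i>) (bdry_nhds \<eta>) sequentially"
    by (auto simp: limit_set_def)
  show "\<eta> \<in> insert Infinity_Pt (\<Union>j. disc_arc j)"
  proof (cases \<eta>)
    case (Real_Pt x)
    then have lim: "(\<lambda>n. g n \<i>) \<longlonglongrightarrow> of_real x"
      using g(2) by (simp add: filterlim_bdry_nhds)
    have "(\<lambda>n. Im (g n \<i>)) \<longlonglongrightarrow> 0" "(\<lambda>n. Re (g n \<i>)) \<longlonglongrightarrow> x"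
      using tendsto_Im[OF lim] tendsto_Re[OF lim] by simp_all
    then have ev: "\<forall>\<^sub>F n in sequentially. Im (g n \<i>) < 1" "\<forall>\<^sub>F n in sequentially. Re (g n \<i>) < x + 1"
      by (auto intro: order_tendstoD)
    define J where "J = nat \<lceil>x + 1\<rceil>"
    have "\<forall>\<^sub>F n in sequentially. g n \<i> \<in> (\<Union>j\<le>J. disc j)"
      using ev
    proof eventually_elim
      case (elim n)
      then have "g n \<i> \<noteq> \<i>" by auto
      then obtain j where j: "g n \<i> \<in> disc j"
        using involution_group_basepoint[of "g n"] g(1) by auto
      then have "real j \<le> x + 1"
        using disc_Re[OF j] elim by linarith
      then have "j \<le> J" unfolding J_def by linarith
      then show ?case using j by blast
    qed
    moreover have "closed (\<Union>j\<le>J. disc j)"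
      by (intro closed_UN) (auto simp: disc_def)
    ultimately have "of_real x \<in> (\<Union>j\<le>J. disc j)"
      using lim by (intro Lim_in_closed_set) auto
    then obtain j where "of_real x \<in> disc j" by blast
    then have "cmod (of_real (ctr j - x)) \<le> rad j"
      by (simp add: disc_def dist_norm)
    then have "\<bar>ctr j - x\<bar> \<le> rad j" by (simp only: norm_of_real)
    then have "\<eta> \<in> disc_arc j"
      unfolding disc_arc_def Real_Pt by (intro imageI) (auto simp: abs_le_iff)
    then show ?thesis by blast
  qed simp
qed

lemma limit_set_involution_group_invariant:
  assumes "g \<in> involution_group" "\<eta> \<in> limit_set involution_group"
  shows "bdry_ext g \<eta> \<in> limit_set involution_group"
proof -
  obtain h where h: "range h \<subseteq> involution_group"
      "filterlim (\<lambda>n::nat. h n \<i>) (bdry_nhds \<eta>) sequentially"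
    using assms(2) by (auto simp: limit_set_def)
  have "g \<in> modular_group" using assms(1) involution_group_subset by blast
  then have "filterlim (\<lambda>n. g (h n \<i>)) (bdry_nhds (bdry_ext g \<eta>)) sequentially"
    by (rule filterlim_compose[OF filterlim_bdry_ext h(2)])
  then have "filterlim (\<lambda>n. compose upper_half_plane g (h n) \<i>) (bdry_nhds (bdry_ext g \<eta>)) sequentially"
    by (simp add: compose_def basepoint_upper)
  moreover have "range (\<lambda>n. compose upper_half_plane g (h n)) \<subseteq> involution_group"
    using h(1) assms(1) compose_involution_group by blast
  ultimately show ?thesis
    unfolding limit_set_def by blast
qed

lemma involution_in_involution_group: "involution j \<in> involution_group"
proof -
  have "involution j = word [j]"
    by (rule extensionalityI[OF _ word_extensional]) (auto simp: involution_def compose_def)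
  then show ?thesis by (simp only: involution_group_def rangeI)
qed

lemma Infinity_in_limit_set: "Infinity_Pt \<in> limit_set involution_group"
proof -
  have "2 * real n \<le> cmod (involution n \<i>)" for n
    using disc_Re[OF involution_in_disc[OF basepoint_upper basepoint_notin_disc], of n]
      abs_Re_le_cmod[of "involution n \<i>"] by linarith
  then have "\<forall>\<^sub>F n in sequentially. 2 * real n \<le> cmod (involution n \<i>)"
    by (rule always_eventually[OF allI])
  moreover have "filterlim (\<lambda>n. 2 * real n) at_top sequentially"
    by real_asymp
  ultimately have "filterlim (\<lambda>n. cmod (involution n \<i>)) at_top sequentially"
    by (rule filterlim_at_top_mono[rotated])
  then have "filterlim (\<lambda>n. involution n \<i>) at_infinity sequentially"
    by (rule filterlim_norm_at_top_imp_at_infinity)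
  then have "filterlim (\<lambda>n. involution n \<i>) (bdry_nhds Infinity_Pt) sequentially"
    by (simp add: filterlim_bdry_nhds involution_in_upper basepoint_upper)
  then show ?thesis
    unfolding limit_set_def using involution_in_involution_group
    by (intro CollectI exI[of _ involution]) auto
qed

lemma bdry_ext_involution_Infinity: "bdry_ext (involution j) Infinity_Pt = Real_Pt (ctr j)"
proof (rule bdry_ext_eqI)
  let ?F = "bdry_nhds Infinity_Pt"
  let ?f = "\<lambda>z. of_real (ctr j) - of_real ((rad j)\<^sup>2) / (z - of_real (ctr j)) :: complex"
  have "filterlim (\<lambda>z. z) at_infinity ?F"
    using filterlim_ident[of ?F] unfolding filterlim_bdry_nhds by simp
  then have "filterlim (\<lambda>z. - of_real (ctr j) + z :: complex) at_infinity ?F"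
    by (rule tendsto_add_filterlim_at_infinity[OF tendsto_const])
  then have "(?f \<longlongrightarrow> of_real (ctr j) - 0) ?F"
    by (intro tendsto_diff tendsto_const tendsto_divide_0[OF tendsto_const]) simp
  moreover have "\<forall>\<^sub>F z in ?F. ?f z = involution j z"
    using eventually_bdry_nhds_upper by (rule eventually_mono) (simp add: involution_def)
  ultimately have "(involution j \<longlongrightarrow> of_real (ctr j)) ?F"
    using tendsto_cong by force
  moreover have "\<forall>\<^sub>F z in ?F. involution j z \<in> upper_half_plane"
    using eventually_bdry_nhds_upper by (rule eventually_mono) (rule involution_in_upper)
  ultimately show "filterlim (involution j) (bdry_nhds (Real_Pt (ctr j))) ?F"
    by (simp add: filterlim_bdry_nhds)
qed

lemma nonelementary_involution_group: "nonelementary involution_group"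
proof -
  have "Real_Pt (ctr j) \<in> limit_set involution_group" for j
    using limit_set_involution_group_invariant[OF involution_in_involution_group Infinity_in_limit_set, of j]
    by (simp only: bdry_ext_involution_Infinity)
  then have "{Infinity_Pt, Real_Pt (ctr 0), Real_Pt (ctr 1)} \<subseteq> limit_set involution_group"
    using Infinity_in_limit_set by blast
  moreover have "ctr 0 < ctr 1"
    using ctr_bounds[of 0] ctr_bounds[of 1] rad_pos[of 0] rad_pos[of 1] by simp
  then have "card {Infinity_Pt, Real_Pt (ctr 0), Real_Pt (ctr 1)} = 3"
    by simp
  ultimately show ?thesis
    unfolding nonelementary_def by blast
qed

section \<open>Very well approximable points\<close>

text \<open>
  The group elements that are paired with the arc \<open>j\<close> in the cover below. Their matrices have entries
  of absolute value at most \<open>2\<^sup>j\<close>.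
\<close>

definition short_elements :: "nat \<Rightarrow> (complex \<Rightarrow> complex) set" where
  "short_elements j = {g \<in> involution_group. 2 * cosh (displacement g) \<le> 4 ^ j}"

lemma VWA_subset_limsup:
  "VWA involution_group Infinity_Pt \<subseteq> (\<lambda>g. bdry_ext g Infinity_Pt) ` involution_group
     \<union> (\<Union>j\<in>{N..}. \<Union>g\<in>short_elements j. bdry_ext g ` disc_arc j)"
proof
  fix \<eta> assume \<eta>: "\<eta> \<in> VWA involution_group Infinity_Pt"
  then have lim: "\<eta> \<in> limit_set involution_group"
    by (auto simp: VWA_def radial_limit_set_def limit_set_def)
  show "\<eta> \<in> (\<lambda>g. bdry_ext g Infinity_Pt) ` involution_group
     \<union> (\<Union>j\<in>{N..}. \<Union>g\<in>short_elements j. bdry_ext g ` disc_arc j)"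
  proof (cases "\<eta> \<in> (\<lambda>g. bdry_ext g Infinity_Pt) ` involution_group")
    case False
    define \<Phi> where "\<Phi> g = neg_log (dist (bdry_ext g Infinity_Pt) \<eta>) / ereal (displacement g)" for g
    have "1 < approx_exponent involution_group Infinity_Pt \<eta>"
      using \<eta> by (simp add: VWA_def)
    then obtain c where c: "1 < ereal c" "ereal c < approx_exponent involution_group Infinity_Pt \<eta>"
      using ereal_dense2 by blast
    then have "c > 1" by simp
    have "\<not> (\<forall>\<^sub>F g in inf (filtercomap displacement at_top) (principal involution_group). \<Phi> g \<le> ereal c)"
      using c(2) Limsup_bounded[of \<Phi> "ereal c"] unfolding approx_exponent_def \<Phi>_def[symmetric]
      by (meson not_le)
    then have freq: "\<exists>g\<in>involution_group. displacement g \<ge> D \<and> \<Phi> g > ereal c" for D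
      unfolding eventually_inf_principal eventually_filtercomap_at_top_linorder by (metis not_le)
    \<comment> \<open>The threshold beyond which \<open>1/(2j + 2) \<le> 4 e\<^bsup>-(c-1)t\<^esup>\<close> forces \<open>t + 1 \<le> j\<close>.\<close>
    have "\<forall>\<^sub>F t in at_top. t + 1 \<le> exp ((c - 1) * t) / 8 - 1"
      using \<open>c > 1\<close> by real_asymp
    then obtain D where D: "\<And>t. t \<ge> D \<Longrightarrow> t + 1 \<le> exp ((c - 1) * t) / 8 - 1"
      by (auto simp: eventually_at_top_linorder)
    obtain g where g: "g \<in> involution_group" "displacement g \<ge> max (max D (real N)) 1" "\<Phi> g > ereal c"
      using freq by blast
    define t where "t = displacement g"
    have t: "t \<ge> D" "t \<ge> real N" "t \<ge> 1" using g(2) by (auto simp: t_def)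
    have close: "dist (bdry_ext g Infinity_Pt) \<eta> < exp (- c * t)"
    proof -
      have pos: "dist (bdry_ext g Infinity_Pt) \<eta> > 0"
        using False g(1) by auto
      then have "c < - ln (dist (bdry_ext g Infinity_Pt) \<eta>) / t"
        using g(3) t by (simp add: \<Phi>_def neg_log_def t_def[symmetric])
      then have "c * t < - ln (dist (bdry_ext g Infinity_Pt) \<eta>)"
        using t by (simp only: pos_less_divide_eq)
      then have "exp (ln (dist (bdry_ext g Infinity_Pt) \<eta>)) < exp (- c * t)"
        by (subst exp_less_cancel_iff) linarith
      then show ?thesis by (simp only: exp_ln[OF pos])
    qed
    obtain h where h: "h \<in> involution_group" "\<And>z. z \<in> upper_half_plane \<Longrightarrow> h (g z) = z"
        "\<And>z. z \<in> upper_half_plane \<Longrightarrow> g (h z) = z"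
      using involution_group_inverse[OF g(1)] by blast
    have gh: "g \<in> modular_group" "h \<in> modular_group"
      using g(1) h(1) involution_group_subset by auto
    have inv: "bdry_ext h (bdry_ext g Infinity_Pt) = Infinity_Pt" "bdry_ext g (bdry_ext h \<eta>) = \<eta>"
      using bdry_ext_left_inverse gh h by auto
    have cosh: "2 * cosh (displacement g) \<le> 2 * exp t" "displacement h = t"
      using displacement_left_inverse[OF gh h(2)] t by (auto simp: cosh_def t_def)
    have "dist Infinity_Pt (bdry_ext h \<eta>) \<le> 4 * cosh t * dist (bdry_ext g Infinity_Pt) \<eta>"
      using dist_bdry_ext_le[OF gh(2), of "bdry_ext g Infinity_Pt" \<eta>] by (simp add: inv cosh)
    also have "\<dots> \<le> 4 * exp t * exp (- c * t)"
      using close cosh(1) by (intro mult_mono) (auto simp: t_def)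
    also have "\<dots> = 4 / exp ((c - 1) * t)"
      by (simp add: exp_minus divide_simps left_diff_distrib flip: exp_add)
    finally have far: "dist Infinity_Pt (bdry_ext h \<eta>) \<le> 4 / exp ((c - 1) * t)" .
    have "bdry_ext h \<eta> \<in> limit_set involution_group"
      using h(1) lim by (rule limit_set_involution_group_invariant)
    moreover have "bdry_ext h \<eta> \<noteq> Infinity_Pt"
      using inv(2) False g(1) by (metis imageI)
    ultimately obtain j where in_arc: "bdry_ext h \<eta> \<in> disc_arc j"
      using limit_set_involution_group_subset by blast
    then obtain x where x: "bdry_ext h \<eta> = Real_Pt x" "ctr j - rad j \<le> x" "x \<le> ctr j + rad j"
      by (auto simp: disc_arc_def)
    have "1 / (2 * real j + 2) \<le> 1 / (1 + \<bar>x\<bar>)"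
      using x ctr_bounds[of j] by (intro divide_left_mono) auto
    also have "\<dots> \<le> 4 / exp ((c - 1) * t)"
      using far dist_Infinity_Real_ge[of x] by (simp add: x)
    finally have "exp ((c - 1) * t) / 8 - 1 \<le> real j"
      by (simp add: divide_simps split: if_splits)
    then have j: "t + 1 \<le> real j" using D[OF t(1)] by linarith
    \<comment> \<open>Since \<open>2 \<le> e \<le> 4\<close>, also \<open>2 e\<^sup>t \<le> e\<^bsup>t + 1\<^esup> \<le> 4\<^sup>j\<close>.\<close>
    have "2 * exp t \<le> exp 1 * exp t"
      using exp_ge_add_one_self[of 1] by (intro mult_right_mono) auto
    also have "\<dots> \<le> exp (real j)"
      using j by (simp flip: exp_add)
    also have "\<dots> = exp 1 ^ j"
      by (simp flip: exp_of_nat_mult)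
    also have "\<dots> \<le> 4 ^ j"
      using exp_le by (intro power_mono) auto
    finally have "2 * cosh (displacement g) \<le> 4 ^ j"
      using cosh(1) by linarith
    then have "g \<in> short_elements j" using g(1) by (simp add: short_elements_def)
    moreover have "\<eta> \<in> bdry_ext g ` disc_arc j"
      using imageI[OF in_arc, of "bdry_ext g"] by (simp only: inv)
    moreover have "j \<in> {N..}" using j t(2) by simp
    ultimately show ?thesis by blast
  qed blast
qed

lemma bounded_bdry: "bounded (S :: bdry set)"
  unfolding bounded_def using pi_gt_zero
  by (auto intro!: exI[of _ Infinity_Pt] exI[of _ pi] simp: dist_bdry_def)

lemma diameter_disc_arc_image:
  assumes "g \<in> short_elements j"
  shows "diameter (bdry_ext g ` disc_arc j) \<le> 4 * 4 ^ j / 4 ^ (j ^ 2)"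
proof -
  have gh: "g \<in> modular_group" "2 * cosh (displacement g) \<le> 4 ^ j"
    using assms involution_group_subset by (auto simp: short_elements_def)
  have rad: "rad j \<le> 1 / 4 ^ (j ^ 2)"
  proof -
    have "(scale j)\<^sup>2 = 4 ^ (j ^ 2)"
      by (simp add: scale_def power2_eq_square[of "2 ^ _"] flip: power_mult_distrib)
    then show ?thesis by (simp add: rad_def frac_le)
  qed
  have *: "dist (bdry_ext g \<xi>) (bdry_ext g \<eta>) \<le> 4 * 4 ^ j / 4 ^ (j ^ 2)"
    if "\<xi> \<in> disc_arc j" "\<eta> \<in> disc_arc j" for \<xi> \<eta>
  proof -
    obtain x y where xy: "\<xi> = Real_Pt x" "\<eta> = Real_Pt y" "\<bar>x - y\<bar> \<le> 2 * rad j"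
      using \<open>\<xi> \<in> disc_arc j\<close> \<open>\<eta> \<in> disc_arc j\<close> by (auto simp: disc_arc_def abs_le_iff)
    have "dist (bdry_ext g \<xi>) (bdry_ext g \<eta>) \<le> 4 * cosh (displacement g) * dist \<xi> \<eta>"
      by (rule dist_bdry_ext_le[OF gh(1)])
    also have "\<dots> \<le> (2 * 4 ^ j) * (2 * (1 / 4 ^ (j ^ 2)))"
    proof (rule mult_mono)
      show "4 * cosh (displacement g) \<le> 2 * 4 ^ j" using gh(2) by linarith
      show "dist \<xi> \<eta> \<le> 2 * (1 / 4 ^ (j ^ 2))"
        using dist_Real_Pt_le[of x y] xy(3) rad unfolding xy(1,2) by linarith
    qed auto
    finally show ?thesis by simp
  qed
  have "disc_arc j \<noteq> {}" using rad_pos[of j] by (auto simp: disc_arc_def)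
  then show ?thesis
    using * by (auto simp: diameter_def intro!: cSUP_least)
qed

lemma hausdorff_dim_VWA: "hausdorff_dim (VWA involution_group Infinity_Pt) = 0"
proof (rule hausdorff_dim_eq_0I[OF _ VWA_subset_limsup _ bounded_bdry diameter_disc_arc_image])
  have "countable involution_group" by (simp add: involution_group_def)
  then show "countable ((\<lambda>g. bdry_ext g Infinity_Pt) ` involution_group)" by simp
  have sub: "short_elements j \<subseteq> {g \<in> modular_group. 2 * cosh (displacement g) \<le> (real (2 ^ j))\<^sup>2}" for j
    using involution_group_subset
    by (auto simp: short_elements_def power2_eq_square simp flip: power_mult_distrib)
  show "finite (short_elements j)" for j
    using sub finite_modular_group_displacement by (rule finite_subset)
  show "(\<lambda>j. 4 * 4 ^ j / 4 ^ (j ^ 2) :: real) \<longlonglongrightarrow> 0"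
    by real_asymp
  fix s :: real assume s: "s > 0"
  have card: "real (card (short_elements j)) \<le> (2 * 2 ^ j + 1) ^ 4" for j
  proof -
    have "card (short_elements j) \<le> (2 * 2 ^ j + 1) ^ 4"
      using card_mono[OF finite_modular_group_displacement sub] card_modular_group_displacement
      by (rule order_trans)
    then have "real (card (short_elements j)) \<le> real ((2 * 2 ^ j + 1) ^ 4)" by (simp only: of_nat_le_iff)
    then show ?thesis by (simp add: add.commute)
  qed
  have "(\<lambda>j. (2 * 2 ^ j + 1) ^ 4 * (4 * 4 ^ j / 4 ^ (j ^ 2)) powr s :: real) \<in> O(\<lambda>j. (1 / 2) ^ j)"
    using s by real_asymp
  then have "summable (\<lambda>j. (2 * 2 ^ j + 1) ^ 4 * (4 * 4 ^ j / 4 ^ (j ^ 2)) powr s :: real)"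
    by (rule summable_comparison_test_bigo[rotated]) (simp add: norm_power summable_geometric)
  then show "summable (\<lambda>j. real (card (short_elements j)) * (4 * 4 ^ j / 4 ^ (j ^ 2)) powr s)"
  proof (rule summable_comparison_test'[where N = 0])
    show "norm (real (card (short_elements j)) * (4 * 4 ^ j / 4 ^ (j ^ 2)) powr s)
        \<le> (2 * 2 ^ j + 1) ^ 4 * (4 * 4 ^ j / 4 ^ (j ^ 2)) powr s" for j
      using mult_right_mono[OF card] by simp
  qed
qed auto

theorem proposition7p32:
  shows "\<exists>(G :: (complex \<Rightarrow> complex) set) (\<xi> :: bdry).
    fuchsian_group G \<and> nonelementary G \<and> \<xi> \<in> limit_set G \<and> hausdorff_dim (VWA G \<xi>) = 0"
  using fuchsian_involution_group nonelementary_involution_group Infinity_in_limit_set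
    hausdorff_dim_VWA
  by blast

end
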